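(* As formal power series in $x$ (with coefficients polynomials in the indeterminates $a,\bar a,b,\bar b,p,q,y,t$), $$1+\sum_{n=1}^{\infty}X_n(a,\bar a,b,\bar b,p,q,y,t)\,x^{n}=\cfrac{1}{1-\beta_0x-\cfrac{\lambda_1x^2}{1-\beta_1x-\cfrac{\lambda_2x^2}{1-\beta_2x-\cdots}}}$$ where for all $n\ge 1$ $$\beta_{n-1}=[\bar a,n,b]_{p,q}\,[a,n,\bar b]_{p,q}+ty\,[a,n]_{p,q}\,[b,n]_{q,p},$$ $$\lambda_n=t\,[a,n]_{p,q}\,[a,n+1,\bar b]_{p,q}\,[b,n]_{q,p}\,[\bar a,n+1,b]_{p,q}.$$ In particular $\beta_0=ab(\bar a\bar b+ty)$ and $\lambda_1=abt(ap+\bar bq)(\bar ap+bq)$.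
   Context: Permutations $\sigma\in\mathfrak S_m$ of $[m]=\{1,\dots,m\}$ are written as words $\sigma_1\sigma_2\cdots\sigma_m$. A descent of $\sigma$ is a pair $(\sigma_i,\sigma_{i+1})$ with $\sigma_i>\sigma_{i+1}$; $\sigma_i$ is the descent top and $\sigma_{i+1}$ the descent bottom; $\mathrm{des}\,\sigma$ is the number of descents. A descent is even-odd if its top is even and its bottom is odd. $\mathcal X_{2n}$ is the set of $\sigma\in\mathfrak S_{2n}$ all of whose descents are even-odd. The value $\sigma_i$ is a left-to-right maximum if $\sigma_j<\sigma_i$ for all $j<i$, and a right-to-left minimum if $\sigma_i<\sigma_j$ for all $j>i$. $\mathrm{lema}\,\sigma$ and $\mathrm{loma}\,\sigma$ are the numbers of even and odd left-to-right maxima; $\mathrm{remi}\,\sigma$ and $\mathrm{romi}\,\sigma$ are the numbers of even and odd right-to-left minima. For $\sigma\in\mathfrak S_m$, $(31\text{-}2)\sigma$ is the number of pairs $(i,j)$ with $2\le i<j\le m$ and $\sigma_{i-1}>\sigma_j>\sigma_i$; $(2\text{-}31)\sigma$ is the number of pairs $(i,j)$ with $1\le i<j\le m-1$ and $\sigma_j>\sigma_i>\sigma_{j+1}$. For $\sigma\in\mathcal X_{2n}$, $\mathrm{dom}(\sigma)$ is the number of $j\in[n]$ such that $2j$ is a descent top and $2j-1$ is a descent bottom of $\sigma$ (not necessarily of the same descent). $$X_n(a,\bar a,b,\bar b,p,q,y,t)=\sum_{\sigma\in\mathcal X_{2n}}a^{\mathrm{lema}\,\sigma}\bar a^{\mathrm{loma}\,\sigma}b^{\mathrm{romi}\,\sigma}\bar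 b^{\mathrm{remi}\,\sigma}p^{(2\text{-}31)\sigma}q^{(31\text{-}2)\sigma}y^{\mathrm{dom}\,\sigma}t^{\mathrm{des}\,\sigma}.$$ For $n\ge 2$, $[x,n,y]_{p,q}=xp^{n-1}+\sum_{i=1}^{n-2}p^{n-1-i}q^i+yq^{n-1}$, and $[x,1,y]_{p,q}=xy$. For $n\ge1$, $[x,n]_{p,q}=xp^{n-1}+\sum_{i=1}^{n-1}p^{n-1-i}q^i$ (so $[x,1]_{p,q}=x$). $[x,n]_{q,p}$ is obtained from $[x,n]_{p,q}$ by exchanging $p$ and $q$. *)

theory Defs
  imports
    "HOL-Computational_Algebra.Formal_Power_Series"
    "HOL-Combinatorics.Permutations"
begin

section \<open>Permutation statistics\<close>

text \<open>
  A word \<open>\<sigma>\<^sub>1\<dots>\<sigma>\<^sub>m\<close> is a function \<open>\<sigma>\<close> with \<open>\<sigma> permutes {1..m}\<close>; its \<open>i\<close>-th letter is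
  \<open>\<sigma> i\<close>. The statistics take the length \<open>m\<close> as an explicit argument.
\<close>

definition descents :: "nat \<Rightarrow> (nat \<Rightarrow> nat) \<Rightarrow> (nat \<times> nat) set" where
  "descents m \<sigma> = {(\<sigma> i, \<sigma> (i + 1)) | i. 1 \<le> i \<and> i < m \<and> \<sigma> i > \<sigma> (i + 1)}"

definition descent_tops :: "nat \<Rightarrow> (nat \<Rightarrow> nat) \<Rightarrow> nat set" where
  "descent_tops m \<sigma> = fst ` descents m \<sigma>"

definition descent_bottoms :: "nat \<Rightarrow> (nat \<Rightarrow> nat) \<Rightarrow> nat set" where
  "descent_bottoms m \<sigma> = snd ` descents m \<sigma>"

definition des :: "nat \<Rightarrow> (nat \<Rightarrow> nat) \<Rightarrow> nat" where
  "des m \<sigma> = card (descents m \<sigma>)"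

definition even_odd_perms :: "nat \<Rightarrow> (nat \<Rightarrow> nat) set" where
  "even_odd_perms n =
     {\<sigma>. \<sigma> permutes {1..2 * n} \<and> (\<forall>(u, v) \<in> descents (2 * n) \<sigma>. even u \<and> odd v)}"

definition lr_maxima :: "nat \<Rightarrow> (nat \<Rightarrow> nat) \<Rightarrow> nat set" where
  "lr_maxima m \<sigma> = {\<sigma> i | i. i \<in> {1..m} \<and> (\<forall>j \<in> {1..m}. j < i \<longrightarrow> \<sigma> j < \<sigma> i)}"

definition rl_minima :: "nat \<Rightarrow> (nat \<Rightarrow> nat) \<Rightarrow> nat set" where
  "rl_minima m \<sigma> = {\<sigma> i | i. i \<in> {1..m} \<and> (\<forall>j \<in> {1..m}. j > i \<longrightarrow> \<sigma> i < \<sigma> j)}"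

definition lema :: "nat \<Rightarrow> (nat \<Rightarrow> nat) \<Rightarrow> nat" where
  "lema m \<sigma> = card {v \<in> lr_maxima m \<sigma>. even v}"

definition loma :: "nat \<Rightarrow> (nat \<Rightarrow> nat) \<Rightarrow> nat" where
  "loma m \<sigma> = card {v \<in> lr_maxima m \<sigma>. odd v}"

definition remi :: "nat \<Rightarrow> (nat \<Rightarrow> nat) \<Rightarrow> nat" where
  "remi m \<sigma> = card {v \<in> rl_minima m \<sigma>. even v}"

definition romi :: "nat \<Rightarrow> (nat \<Rightarrow> nat) \<Rightarrow> nat" where
  "romi m \<sigma> = card {v \<in> rl_minima m \<sigma>. odd v}"

definition pat_31_2 :: "nat \<Rightarrow> (nat \<Rightarrow> nat) \<Rightarrow> nat" where
  "pat_31_2 m \<sigma> = card {(i, j). 2 \<le> i \<and> i < j \<and> j \<le> m \<and> \<sigma> (i - 1) > \<sigma> j \<and> \<sigma> j > \<sigma> i}"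

definition pat_2_31 :: "nat \<Rightarrow> (nat \<Rightarrow> nat) \<Rightarrow> nat" where
  "pat_2_31 m \<sigma> = card {(i, j). 1 \<le> i \<and> i < j \<and> j \<le> m - 1 \<and> \<sigma> j > \<sigma> i \<and> \<sigma> i > \<sigma> (j + 1)}"

definition dom_stat :: "nat \<Rightarrow> (nat \<Rightarrow> nat) \<Rightarrow> nat" where
  "dom_stat n \<sigma> =
     card {j \<in> {1..n}. 2 * j \<in> descent_tops (2 * n) \<sigma> \<and> 2 * j - 1 \<in> descent_bottoms (2 * n) \<sigma>}"

text \<open>
  The weights range over an arbitrary commutative ring. The identity between polynomials in
  indeterminates is the instance where the ring is a polynomial ring and the weights are its
  variables.
\<close>

definition Xpoly ::
  "nat \<Rightarrow> 'a \<Rightarrow> 'a \<Rightarrow> 'a \<Rightarrow> 'a \<Rightarrow> 'a \<Rightarrow> 'a \<Rightarrow> 'a \<Rightarrow> 'a \<Rightarrow> 'a :: comm_ring_1" where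
  "Xpoly n a abar b bbar p q y t =
     (\<Sum>\<sigma> \<in> even_odd_perms n.
        a ^ lema (2 * n) \<sigma> * abar ^ loma (2 * n) \<sigma> *
        b ^ romi (2 * n) \<sigma> * bbar ^ remi (2 * n) \<sigma> *
        p ^ pat_2_31 (2 * n) \<sigma> * q ^ pat_31_2 (2 * n) \<sigma> *
        y ^ dom_stat n \<sigma> * t ^ des (2 * n) \<sigma>)"

section \<open>Bracket polynomials\<close>

text \<open>
  \<open>bracket3 p q x n y\<close> is \<open>[x, n, y]\<close> and \<open>bracket2 p q x n\<close> is \<open>[x, n]\<close>, both with
  subscript \<open>p, q\<close>. Only the values at \<open>n \<ge> 1\<close> are meaningful.
\<close>

definition bracket3 :: "'a \<Rightarrow> 'a \<Rightarrow> 'a \<Rightarrow> nat \<Rightarrow> 'a \<Rightarrow> 'a :: comm_ring_1" where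
  "bracket3 p q x n y =
     (if n = 1 then x * y
      else x * p ^ (n - 1) + (\<Sum>i = 1..n - 2. p ^ (n - 1 - i) * q ^ i) + y * q ^ (n - 1))"

definition bracket2 :: "'a \<Rightarrow> 'a \<Rightarrow> 'a \<Rightarrow> nat \<Rightarrow> 'a :: comm_ring_1" where
  "bracket2 p q x n = x * p ^ (n - 1) + (\<Sum>i = 1..n - 1. p ^ (n - 1 - i) * q ^ i)"

section \<open>Jacobi continued fractions\<close>

text \<open>
  \<open>jfrac_convergent \<beta> l N k\<close> is the finite continued fraction
  \<open>1 / (1 - \<beta>\<^sub>k x - l\<^sub>k\<^sub>+\<^sub>1 x\<^sup>2 / (1 - \<beta>\<^sub>k\<^sub>+\<^sub>1 x - \<dots> - l\<^sub>k\<^sub>+\<^sub>N x\<^sup>2 / (1 - \<beta>\<^sub>k\<^sub>+\<^sub>N x)))\<close>.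
  Over a commutative ring, division needs the library's one-sided inverse with prescribed
  constant coefficient; all denominators have constant coefficient 1, so this is the
  inverse in the ring of power series.
\<close>

primrec jfrac_convergent ::
  "(nat \<Rightarrow> 'a) \<Rightarrow> (nat \<Rightarrow> 'a) \<Rightarrow> nat \<Rightarrow> nat \<Rightarrow> 'a :: comm_ring_1 fps" where
  "jfrac_convergent \<beta> l 0 k = fps_right_inverse (1 - fps_const (\<beta> k) * fps_X) 1"
| "jfrac_convergent \<beta> l (Suc N) k =
     fps_right_inverse
       (1 - fps_const (\<beta> k) * fps_X
          - fps_const (l (k + 1)) * fps_X ^ 2 * jfrac_convergent \<beta> l N (k + 1)) 1"

lemma jfrac_convergent_0_mult:
  "(1 - fps_const (\<beta> k) * fps_X) * jfrac_convergent \<beta> l 0 k = 1"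
  unfolding jfrac_convergent.simps by (rule fps_right_inverse) simp

lemma jfrac_convergent_Suc_mult:
  "(1 - fps_const (\<beta> k) * fps_X
      - fps_const (l (k + 1)) * fps_X ^ 2 * jfrac_convergent \<beta> l N (k + 1))
     * jfrac_convergent \<beta> l (Suc N) k = 1"
  unfolding jfrac_convergent.simps by (rule fps_right_inverse) (simp add: power2_eq_square)

text \<open>
  The value of the infinite fraction is the limit of its convergents in the metric of
  \<open>'a fps\<close>, which is the \<open>x\<close>-adic one. Limits are unique, so at most one series satisfies this.
\<close>

definition is_jfrac :: "'a :: comm_ring_1 fps \<Rightarrow> (nat \<Rightarrow> 'a) \<Rightarrow> (nat \<Rightarrow> 'a) \<Rightarrow> bool" where
  "is_jfrac F \<beta> l \<longleftrightarrow> (\<lambda>N. jfrac_convergent \<beta> l N 0) \<longlonglongrightarrow> F"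

end

theory Submission
  imports Defs "HOL-Library.Multiset"
begin

text \<open>
  A permutation is built by inserting its letters in the order \<open>1, 2, 3, \<dots>\<close>. At every stage the
  letters present form blocks, maximal runs of adjacent positions, separated by gaps to be filled
  with larger letters. With the convention that there is always a first block, possibly empty,
  at the left end, a letter inserted into one of the \<open>h + 1\<close> gaps behind the blocks \<open>0, \<dots>, h\<close>
  is attached to the block to its left (double ascent), or forms a new block (valley), or
  joins the two blocks next to the gap (peak, not in the last gap). Attaching it only to the block
  on its right would make it a descent top and a descent bottom at once. All descents are
  even-odd precisely if odd letters are double ascents or valleys and even letters are double
  ascents or peaks.

  Every statistic is a sum of contributions of single letters that are settled when the letter is
  inserted (\<open>letter_wt_replace\<close>). The letter is a left-to-right maximum if it becomes the end of
  block \<open>0\<close> or joins block \<open>0\<close> to the next one, and a right-to-left minimum if it goes into the last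
  gap. After the insertion every block except block \<open>0\<close> is entered by a descent from a larger letter
  to come, and the descents straddling the new letter are these, except for one that enters at
  the new letter itself. Summing over the gap chosen therefore gives the brackets
  \<open>[\<cdot>, h + 1, \<cdot>]\<close> for double ascents, \<open>t\<close> times \<open>[b, h + 1]\<close> with \<open>p\<close> and \<open>q\<close> exchanged for
  valleys, and \<open>[a, h]\<close> for peaks. The letters \<open>2 j - 1\<close> and \<open>2 j\<close> together change \<open>h\<close> by at most one,
  and \<open>y\<close> is earned exactly when \<open>2 j - 1\<close> is a valley and \<open>2 j\<close> a peak. So the weighted sums over the
  partial words satisfy a tridiagonal recurrence (\<open>state_sum_step\<close>) with diagonal \<open>\<beta>\<close> and with
  products of opposite off-diagonal entries \<open>lam\<close>. The solution of such a recurrence at height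
  \<open>0\<close> is the Jacobi continued fraction (\<open>is_jfrac_tridiagonal\<close>).
\<close>

section \<open>Straddling descents and the surroundings of a letter\<close>

text \<open>
  Reading the two patterns from the letter that plays the role of 2, they count the descents
  straddling that letter to its left and to its right. The comparison is strict, so a letter
  never straddles itself, and a descent next to the letter is not counted.
\<close>

fun straddles :: "nat \<Rightarrow> nat list \<Rightarrow> nat" where
  "straddles x (u # v # w) = (if v < x \<and> x < u then 1 else 0) + straddles x (v # w)"
| "straddles x _ = 0"

lemma straddles_append:
  "straddles x (A @ c # B) = straddles x (A @ [c]) + straddles x (c # B)"
  by (induction x A rule: straddles.induct) auto

lemma straddles_snoc_gt: "x < c \<Longrightarrow> straddles x (A @ [c]) = straddles x A"
  by (induction x A rule: straddles.induct) auto

lemma straddles_Cons_gt: "x < c \<Longrightarrow> x < d \<Longrightarrow> straddles x (c # B) = straddles x (d # B)"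
  by (cases B) auto

lemma straddles_Cons_replace:
  assumes "\<forall>z\<in>set r. x < z" "x < c" "x < d"
  shows "straddles x (c # r @ B) = straddles x (d # B)"
  using assms
proof (induction r arbitrary: c)
  case Nil
  then show ?case using straddles_Cons_gt[of x c d B] by simp
qed auto

text \<open>
  Seen from \<open>x\<close>, a run of letters exceeding \<open>x\<close> acts as one large letter: descents inside
  the run lie entirely above \<open>x\<close>, and at its ends only the comparison with \<open>x\<close> counts.
\<close>

lemma straddles_replace:
  assumes "r \<noteq> []" "\<forall>z\<in>set r. x < z" "x < d"
  shows "straddles x (A @ r @ B) = straddles x (A @ d # B)"
proof -
  obtain c r' where r: "r = c # r'" using assms(1) by (cases r) auto
  show ?thesis
    using straddles_append[of x A c "r' @ B"] straddles_append[of x A d B] assms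
      straddles_Cons_replace[of r' x c d B]
    by (simp add: r straddles_snoc_gt)
qed

text \<open>
  The local data of a letter are functions of the letter and the word, not of a position, because
  a position changes under every later insertion. Both cut at the first occurrence of \<open>x\<close>, which
  is harmless because only the letters that occur once get a weight.
\<close>

definition before :: "nat \<Rightarrow> nat list \<Rightarrow> nat list" where
  "before x w = takeWhile (\<lambda>z. z \<noteq> x) w"

definition after :: "nat \<Rightarrow> nat list \<Rightarrow> nat list" where
  "after x w = tl (dropWhile (\<lambda>z. z \<noteq> x) w)"

definition is_bottom :: "nat \<Rightarrow> nat list \<Rightarrow> bool" where
  "is_bottom x w \<longleftrightarrow> before x w \<noteq> [] \<and> x < last (before x w)"

definition is_top :: "nat \<Rightarrow> nat list \<Rightarrow> bool" where
  "is_top x w \<longleftrightarrow> after x w \<noteq> [] \<and> hd (after x w) < x"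

lemma before_split: "x \<notin> set A \<Longrightarrow> before x (A @ x # B) = A"
  unfolding before_def by (induction A) auto

lemma after_split: "x \<notin> set A \<Longrightarrow> after x (A @ x # B) = B"
  unfolding after_def by (induction A) auto

text \<open>
  Equal neighbours are excluded on purpose: the only repeated letter is the gap marker, so this
  also says that no two gaps are adjacent, that is, every block but the first is nonempty.
\<close>

definition eo_step :: "nat \<Rightarrow> nat \<Rightarrow> bool" where
  "eo_step u v \<longleftrightarrow> u < v \<or> v < u \<and> even u \<and> odd v"

text \<open>
  When \<open>v\<close> exceeds every letter other than \<open>M\<close>, a descent straddling \<open>v\<close> must have top \<open>M\<close>, and every
  \<open>M\<close> in \<open>A\<close> is such a top since a smaller letter follows it.
\<close>

lemma straddles_eq_gaps:
  assumes "successively eo_step (A @ [M])" "set A \<subseteq> {..<v} \<union> {M}" "v < M"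
  shows "straddles v A = count_list A M"
  using assms
proof (induction v A rule: straddles.induct)
  case (1 x u v w)
  then show ?case by (auto simp: eo_step_def)
qed (auto simp: eo_step_def)

lemma straddles_eq_gaps_last:
  assumes "successively eo_step B" "set B \<subseteq> {..<v} \<union> {M}" "v < M" "B \<noteq> []" "last B = M"
  shows "Suc (straddles v B) = count_list B M"
proof -
  obtain C where B: "B = C @ [M]"
    using assms(4,5) by (metis append_butlast_last_id)
  show ?thesis
    using straddles_eq_gaps[of C M v] assms by (simp add: B straddles_snoc_gt)
qed

text \<open>
  The local data of \<open>x\<close> do not see the difference between a gap and what larger letters later put
  in its place. Hence each letter may be weighted once and for all when it is inserted.
\<close>

lemma
  assumes x: "x \<in> set (A @ M # B)" "x < M" and r: "r \<noteq> []" "\<forall>z\<in>set r. x < z"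
  shows is_bottom_replace: "is_bottom x (A @ r @ B) = is_bottom x (A @ M # B)" (is ?thesis1)
    and is_top_replace: "is_top x (A @ r @ B) = is_top x (A @ M # B)" (is ?thesis2)
    and straddles_before_replace:
      "straddles x (before x (A @ r @ B)) = straddles x (before x (A @ M # B))" (is ?thesis3)
    and straddles_after_replace:
      "straddles x (after x (A @ r @ B)) = straddles x (after x (A @ M # B))" (is ?thesis4)
    and lr_maximum_replace:
      "(\<forall>z \<in> set (before x (A @ r @ B)). z < x) = (\<forall>z \<in> set (before x (A @ M # B)). z < x)" (is ?thesis5)
    and rl_minimum_replace:
      "(\<forall>z \<in> set (after x (A @ r @ B)). x < z) = (\<forall>z \<in> set (after x (A @ M # B)). x < z)" (is ?thesis6)
proof -
  let ?all = "?thesis1 \<and> ?thesis2 \<and> ?thesis3 \<and> ?thesis4 \<and> ?thesis5 \<and> ?thesis6"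
  have ?all if "x \<in> set A"
  proof -
    obtain A1 A2 where A: "A = A1 @ x # A2" "x \<notin> set A1"
      using split_list_first[OF \<open>x \<in> set A\<close>] by blast
    have L: "before x (A @ r @ B) = A1" "before x (A @ M # B) = A1"
      and R: "after x (A @ r @ B) = A2 @ r @ B" "after x (A @ M # B) = A2 @ M # B"
      using before_split[OF A(2)] after_split[OF A(2)] by (simp_all add: A(1))
    have "hd (A2 @ r @ B) < x \<longleftrightarrow> hd (A2 @ M # B) < x"
      using r x by (cases A2; cases r) auto
    then show ?all
      using straddles_replace[OF r x(2), of A2 B] r x(2)
      by (auto simp: is_bottom_def is_top_def L R)
  qed
  moreover have ?all if "x \<notin> set A"
  proof -
    have "x \<in> set B" using x that by auto
    then obtain B1 B2 where B: "B = B1 @ x # B2" "x \<notin> set B1"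
      using split_list_first by metis
    have n: "x \<notin> set (A @ r @ B1)" "x \<notin> set (A @ M # B1)"
      using that B(2) r x(2) by auto
    have L: "before x (A @ r @ B) = A @ r @ B1" "before x (A @ M # B) = A @ M # B1"
      and R: "after x (A @ r @ B) = B2" "after x (A @ M # B) = B2"
      using before_split[OF n(1)] after_split[OF n(1)] before_split[OF n(2)] after_split[OF n(2)]
      by (simp_all add: B(1))
    have "x < last (A @ r @ B1) \<longleftrightarrow> x < last (A @ M # B1)"
      using r x by (cases B1 rule: rev_cases) auto
    moreover have "\<not> (\<forall>z\<in>set (A @ r @ B1). z < x)" "\<not> (\<forall>z\<in>set (A @ M # B1). z < x)"
      using r x(2) by (auto simp: neq_Nil_conv)
    ultimately show ?all
      using straddles_replace[OF r x(2), of A B1] r x(2)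
      unfolding is_bottom_def is_top_def L R by auto
  qed
  ultimately show ?thesis1 ?thesis2 ?thesis3 ?thesis4 ?thesis5 ?thesis6
    by blast+
qed

section \<open>Words with gaps and their growth by insertion\<close>

text \<open>
  A permutation is cut down to its letters up to \<open>k\<close> by collapsing each maximal run of larger
  letters to one marker \<open>M\<close>. Taking for \<open>M\<close> an even number larger than all letters makes a descent
  from the marker automatically obey the parity rule for tops, and an ascent to it is always
  legal. The marker at the end of the word stands for the gap behind the last block and never
  disappears, whence \<open>Suc h\<close> markers for \<open>h\<close> joinable gaps. The first block may be empty.
\<close>

context
  fixes M :: nat
begin

definition states :: "nat \<Rightarrow> nat \<Rightarrow> nat list set" where
  "states k h = {w. mset w = mset_set {1..k} + replicate_mset (Suc h) M
                    \<and> successively eo_step w \<and> last w = M}"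

definition splits :: "nat list set \<Rightarrow> (nat list \<times> nat list) set" where
  "splits T = {(A, B). A @ M # B \<in> T}"

lemma mem_splits: "(A, B) \<in> splits T \<longleftrightarrow> A @ M # B \<in> T"
  by (simp add: splits_def)

lemma splits_Cons:
  "splits {x # xs} = (if x = M then {([], xs)} else {}) \<union> (\<lambda>(A, B). (x # A, B)) ` splits {xs}"
proof -
  have "(A, B) \<in> splits {x # xs} \<longleftrightarrow>
      (A, B) \<in> (if x = M then {([], xs)} else {}) \<union> (\<lambda>(A, B). (x # A, B)) ` splits {xs}" for A B
    by (cases A) (auto simp: splits_def image_iff)
  then show ?thesis by auto
qed

lemma finite_splits_word: "finite (splits {w})"
  by (induction w) (auto simp: splits_Cons, simp add: splits_def)

text \<open>
  A gap of a word is a way of writing the word as \<open>A @ M # B\<close>, and the number of markers in \<open>A\<close>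
  ranks the gaps from left to right.
\<close>

lemma sum_splits_word:
  "(\<Sum>(A, B) \<in> splits {w}. f (count_list A M)) = (\<Sum>i < count_list w M. f i)"
proof (induction w arbitrary: f)
  case Nil
  then show ?case by (simp add: splits_def)
next
  case (Cons x xs)
  have inj: "inj_on (\<lambda>(A, B). (x # A, B)) (splits {xs})" by (auto simp: inj_on_def)
  have "(\<Sum>(A, B) \<in> (\<lambda>(A, B). (x # A, B)) ` splits {xs}. f (count_list A M))
      = (\<Sum>(A, B) \<in> splits {xs}. (\<lambda>i. f (if x = M then Suc i else i)) (count_list A M))"
    by (subst sum.reindex[OF inj]) (auto intro!: sum.cong)
  also have "\<dots> = (\<Sum>i < count_list xs M. f (if x = M then Suc i else i))"
    by (rule Cons.IH)
  finally have *: "(\<Sum>(A, B) \<in> (\<lambda>(A, B). (x # A, B)) ` splits {xs}. f (count_list A M))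
      = (\<Sum>i < count_list xs M. f (if x = M then Suc i else i))" .
  show ?case
  proof (cases "x = M")
    case True
    have "(\<Sum>(A, B) \<in> splits {x # xs}. f (count_list A M))
        = f 0 + (\<Sum>(A, B) \<in> (\<lambda>(A, B). (x # A, B)) ` splits {xs}. f (count_list A M))"
      unfolding splits_Cons using True
      by (simp, subst sum.insert) (auto simp: finite_splits_word)
    then show ?thesis using True * by (simp add: sum.lessThan_Suc_shift del: sum.lessThan_Suc)
  qed (use * in \<open>simp add: splits_Cons\<close>)
qed

lemma splits_eq_Union: "splits T = (\<Union>w\<in>T. splits {w})"
  by (auto simp: splits_def)

lemma finite_splits: "finite T \<Longrightarrow> finite (splits T)"
  using splits_eq_Union[of T] by (simp add: finite_splits_word)

lemma sum_splits:
  fixes g f :: "_ \<Rightarrow> 'a :: comm_ring_1"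
  assumes "finite T" "\<And>w. w \<in> T \<Longrightarrow> count_list w M = m"
  shows "(\<Sum>(A, B) \<in> splits T. g (A @ M # B) * f (count_list A M))
       = (\<Sum>w\<in>T. g w) * (\<Sum>i<m. f i)"
proof -
  have "(\<Sum>(A, B) \<in> splits T. g (A @ M # B) * f (count_list A M))
      = (\<Sum>w\<in>T. \<Sum>(A, B) \<in> splits {w}. g (A @ M # B) * f (count_list A M))"
    by (subst splits_eq_Union, rule sum.UNION_disjoint)
      (use assms(1) finite_splits_word in \<open>auto simp: splits_def\<close>)
  also have "\<dots> = (\<Sum>w\<in>T. g w * (\<Sum>i<m. f i))"
  proof (rule sum.cong[OF refl])
    fix w assume w: "w \<in> T"
    have "(\<Sum>(A, B) \<in> splits {w}. g (A @ M # B) * f (count_list A M))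
        = (\<Sum>(A, B) \<in> splits {w}. (\<lambda>i. g w * f i) (count_list A M))"
      by (rule sum.cong) (auto simp: splits_def)
    also have "\<dots> = (\<Sum>i < count_list w M. g w * f i)"
      by (rule sum_splits_word)
    finally show "(\<Sum>(A, B) \<in> splits {w}. g (A @ M # B) * f (count_list A M))
        = g w * (\<Sum>i<m. f i)"
      using assms(2)[OF w] by (simp add: sum_distrib_left)
  qed
  finally show ?thesis by (simp add: sum_distrib_right)
qed

context
  assumes even_M: "even M"
begin

lemma states_set:
  assumes "w \<in> states k h" shows "set w = insert M {1..k}"
proof -
  have "set_mset (mset w) = insert M {1..k}"
    using assms unfolding states_def by auto
  then show ?thesis by simp
qed

lemma states_count:
  assumes "w \<in> states k h" "k < M" shows "count_list w M = Suc h"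
  using assms by (simp add: states_def flip: count_mset)

lemma states_not_Nil: "w \<in> states k h \<Longrightarrow> w \<noteq> []"
  by (auto simp: states_def)

lemma finite_states: "finite (states k h)"
proof (cases "states k h = {}")
  case False
  then obtain w where "w \<in> states k h" by auto
  then have "states k h \<subseteq> {w'. mset w' = mset w}"
    by (auto simp: states_def)
  then show ?thesis by (rule finite_subset) (rule mset_eq_finite)
qed simp

lemma states_0:
  "states 0 h = (if h = 0 then {[M]} else {})"
proof -
  have "w \<in> (if h = 0 then {[M]} else {})" if "w \<in> states 0 h" for w
  proof -
    have "set w = {M}" using states_set[OF that] by simp
    moreover have "length w = Suc h"
    proof -
      have "mset w = replicate_mset (Suc h) M" using that by (simp add: states_def)
      then have "size (mset w) = Suc h" by (simp only: size_replicate_mset)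
      then show ?thesis by simp
    qed
    moreover have "successively eo_step w" using that by (simp add: states_def)
    ultimately show ?thesis
      by (cases w; cases "tl w") (auto simp: eo_step_def)
  qed
  then have "states 0 h \<subseteq> (if h = 0 then {[M]} else {})"
    by (rule subsetI)
  moreover have "[M] \<in> states 0 0" by (simp add: states_def)
  ultimately show ?thesis by (cases "h = 0") auto
qed

lemma states_split_props:
  assumes "A @ M # B \<in> states k h" "k < M"
  shows "set A \<subseteq> insert M {1..k}" "set B \<subseteq> insert M {1..k}"
    "A \<noteq> [] \<Longrightarrow> last A \<in> {1..k}" "B \<noteq> [] \<Longrightarrow> hd B \<in> {1..k} \<and> odd (hd B)"
    "successively eo_step (A @ [M])" "successively eo_step (M # B)"
    "last (M # B) = M"
    "mset A + mset B = mset_set {1..k} + replicate_mset h M"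
    "successively eo_step A" "successively eo_step B"
proof -
  show s: "set A \<subseteq> insert M {1..k}" "set B \<subseteq> insert M {1..k}"
    using states_set[OF assms(1)] by auto
  have c: "successively eo_step (A @ M # B)" "last (A @ M # B) = M"
    using assms(1) by (auto simp: states_def)
  then show "successively eo_step (A @ [M])" "successively eo_step (M # B)" "last (M # B) = M"
    "successively eo_step A" "successively eo_step B"
    by (auto simp: successively_append_iff successively_Cons)
  show "last A \<in> {1..k}" if "A \<noteq> []"
  proof -
    have "eo_step (last A) M" using c that by (simp add: successively_append_iff)
    moreover have "last A \<in> insert M {1..k}" using s(1) last_in_set[OF that] by blast
    ultimately show ?thesis using even_M by (auto simp: eo_step_def)
  qed
  show "hd B \<in> {1..k} \<and> odd (hd B)" if "B \<noteq> []"
  proof -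
    have "eo_step M (hd B)" using c that by (simp add: successively_append_iff successively_Cons)
    moreover have "hd B \<in> insert M {1..k}" using s(2) hd_in_set[OF that] by blast
    ultimately show ?thesis using assms(2) by (auto simp: eo_step_def)
  qed
  show "mset A + mset B = mset_set {1..k} + replicate_mset h M"
    using assms(1) by (simp add: states_def)
qed

text \<open>
  The three ways of inserting the next letter \<open>v\<close> into a gap: at the left end of the gap
  (double ascent), inside it as a new block (valley), or filling it up and thereby joining two
  blocks (peak). The right end of the gap would make \<open>v\<close> both a top and a bottom, so no parity
  allows it.
\<close>

lemma double_ascent_state:
  assumes "A @ M # B \<in> states k h" "v = Suc k" "v < M"
  shows "A @ v # M # B \<in> states v h"
proof -
  note p = states_split_props[OF assms(1)]
  have "eo_step (last A) v" if "A \<noteq> []"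
    using p(3) that assms by (auto simp: eo_step_def)
  then show ?thesis
    using p assms unfolding states_def
    by (auto simp: successively_append_iff successively_Cons eo_step_def atLeastAtMostSuc_conv)
qed

lemma valley_state:
  assumes "A @ M # B \<in> states k h" "v = Suc k" "v < M" "odd v"
  shows "A @ M # v # M # B \<in> states v (Suc h)"
proof -
  note p = states_split_props[OF assms(1)]
  show ?thesis
    using p assms even_M unfolding states_def
    by (auto simp: successively_append_iff successively_Cons eo_step_def atLeastAtMostSuc_conv)
qed

lemma peak_state:
  assumes "A @ M # B \<in> states k (Suc h)" "v = Suc k" "v < M" "even v" "B \<noteq> []"
  shows "A @ v # B \<in> states v h"
proof -
  note p = states_split_props[OF assms(1)]
  have "eo_step (last A) v" if "A \<noteq> []"
    using p(3) that assms by (auto simp: eo_step_def)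
  moreover have "eo_step v (hd B)"
    using p(4) assms by (auto simp: eo_step_def)
  ultimately show ?thesis
    using p assms unfolding states_def
    by (auto simp: successively_append_iff successively_Cons atLeastAtMostSuc_conv)
qed

text \<open>
  For the largest letter, being a bottom or a top just says that its neighbour is a marker or is
  not one. So the neighbours of the largest letter tell how it was inserted, and the insertion can
  be undone.
\<close>

lemma states_at_max:
  assumes w: "A @ v # B \<in> states v h" and v: "v = Suc k" "v < M"
  shows "v \<notin> set A" "B \<noteq> []" "last B = M"
    "mset A + mset B = mset_set {1..k} + replicate_mset (Suc h) M"
    "A = [] \<or> last A \<in> insert M {1..k}" "hd B \<in> insert M {1..k}"
    "successively eo_step A" "successively eo_step B"
    "A = [] \<or> eo_step (last A) v" "eo_step v (hd B)"
    "is_bottom v (A @ v # B) \<longleftrightarrow> A \<noteq> [] \<and> last A = M"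
    "is_top v (A @ v # B) \<longleftrightarrow> hd B \<noteq> M"
proof -
  have c: "last (A @ v # B) = M" "successively eo_step (A @ v # B)"
    and ms: "mset A + mset B = mset_set {1..k} + replicate_mset (Suc h) M"
    using w by (auto simp: states_def v atLeastAtMostSuc_conv)
  then show B: "B \<noteq> []" "last B = M"
    and "successively eo_step A" "successively eo_step B"
    "A = [] \<or> eo_step (last A) v" "eo_step v (hd B)"
    using v by (auto simp: successively_append_iff successively_Cons split: if_splits)
  show "mset A + mset B = mset_set {1..k} + replicate_mset (Suc h) M" by (rule ms)
  have "set_mset (mset A + mset B) = insert M {1..k}" unfolding ms by auto
  then have s: "set A \<subseteq> insert M {1..k}" "set B \<subseteq> insert M {1..k}" by auto
  then show n: "v \<notin> set A" using v by auto
  show lh: "A = [] \<or> last A \<in> insert M {1..k}" "hd B \<in> insert M {1..k}"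
    using s B(1) last_in_set[of A] hd_in_set[of B] by blast+
  show "is_bottom v (A @ v # B) \<longleftrightarrow> A \<noteq> [] \<and> last A = M"
    using lh(1) v unfolding is_bottom_def before_split[OF n] by auto
  show "is_top v (A @ v # B) \<longleftrightarrow> hd B \<noteq> M"
    using lh(2) B(1) v unfolding is_top_def after_split[OF n] by auto
qed

lemma states_max_split:
  assumes "w \<in> states (Suc k) h"
  obtains A B where "w = A @ Suc k # B"
proof -
  have "Suc k \<in> set w" using states_set[OF assms] by auto
  then show ?thesis using that by (auto simp: in_set_conv_decomp)
qed

text \<open>
  An odd letter is never a top, so the letter after \<open>v\<close> is a marker, and the letter before
  \<open>v\<close> decides between a double ascent and a valley.
\<close>

lemma states_odd_double_ascents:
  assumes v: "v = Suc k" "v < M" "odd v"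
  shows "{w \<in> states v h. \<not> is_bottom v w} = (\<lambda>(A, B). A @ v # M # B) ` splits (states k h)"
proof (intro equalityI subsetI)
  fix w assume "w \<in> {w \<in> states v h. \<not> is_bottom v w}"
  then have w: "w \<in> states v h" "\<not> is_bottom v w" by auto
  obtain A B where w_eq: "w = A @ v # B"
    using states_max_split[OF w(1)[unfolded v(1)]] v(1) by auto
  note AB = states_at_max[OF w(1)[unfolded w_eq] v(1,2), folded w_eq]
  have "hd B = M" using AB(6,10) v by (auto simp: eo_step_def)
  then obtain B' where B: "B = M # B'" using AB(2) by (cases B) auto
  have "A = [] \<or> last A \<in> {1..k}" using w(2) AB(5,11) by blast
  then have "A @ M # B' \<in> states k h"
    using AB(3,4,7,8) v(1,2) unfolding B states_def
    by (auto simp: successively_append_iff eo_step_def)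
  then show "w \<in> (\<lambda>(A, B). A @ v # M # B) ` splits (states k h)"
    using w_eq B by (auto simp: mem_splits intro!: image_eqI[of _ _ "(A, B')"])
next
  fix w assume "w \<in> (\<lambda>(A, B). A @ v # M # B) ` splits (states k h)"
  then obtain A B where AB: "A @ M # B \<in> states k h" "w = A @ v # M # B"
    by (auto simp: mem_splits)
  have k: "k < M" using v by simp
  note p = states_split_props[OF AB(1) k]
  have "v \<notin> set A" using p(1) v by auto
  then have "\<not> is_bottom v w"
    using p(3) v by (auto simp: is_bottom_def AB(2) before_split)
  then show "w \<in> {w \<in> states v h. \<not> is_bottom v w}"
    using double_ascent_state[OF AB(1) v(1,2)] AB(2) by simp
qed

lemma states_odd_valleys:
  assumes v: "v = Suc k" "v < M" "odd v"
  shows "{w \<in> states v (Suc h). is_bottom v w} = (\<lambda>(A, B). A @ M # v # M # B) ` splits (states k h)"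
    and "{w \<in> states v 0. is_bottom v w} = {}"
proof -
  have *: "\<exists>A B. w = A @ M # v # M # B \<and> A @ M # B \<in> states k (h' - 1) \<and> h' \<noteq> 0"
    if w: "w \<in> states v h'" "is_bottom v w" for w h'
  proof -
    obtain A B where w_eq: "w = A @ v # B"
    using states_max_split[OF w(1)[unfolded v(1)]] v(1) by auto
  note AB = states_at_max[OF w(1)[unfolded w_eq] v(1,2), folded w_eq]
    have "hd B = M" using AB(6,10) v by (auto simp: eo_step_def)
    then obtain B' where B: "B = M # B'" using AB(2) by (cases B) auto
    obtain A' where A: "A = A' @ [M]"
      using w(2) AB(11) by (metis append_butlast_last_id)
    have "count (mset A + mset B) M = Suc h'" unfolding AB(4) using v by simp
    then have "h' \<noteq> 0" by (simp add: A B)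
    then have "A' @ M # B' \<in> states k (h' - 1)"
      using AB(3,4,7,8) v(1,2) unfolding A B states_def
      by (cases h') (auto simp: successively_append_iff)
    then show ?thesis using w_eq A B \<open>h' \<noteq> 0\<close> by auto
  qed
  then show "{w \<in> states v 0. is_bottom v w} = {}" by blast
  show "{w \<in> states v (Suc h). is_bottom v w} = (\<lambda>(A, B). A @ M # v # M # B) ` splits (states k h)"
  proof (intro equalityI subsetI)
    fix w assume "w \<in> {w \<in> states v (Suc h). is_bottom v w}"
    then show "w \<in> (\<lambda>(A, B). A @ M # v # M # B) ` splits (states k h)"
      using *[of w "Suc h"] by (auto simp: mem_splits intro!: image_eqI[of _ _ "(_, _)"])
  next
    fix w assume "w \<in> (\<lambda>(A, B). A @ M # v # M # B) ` splits (states k h)"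
    then obtain A B where AB: "A @ M # B \<in> states k h" "w = A @ M # v # M # B"
      by (auto simp: mem_splits)
    have k: "k < M" using v by simp
    have "v \<notin> set (A @ [M])" using states_split_props(1)[OF AB(1) k] v by auto
    then have "is_bottom v w"
      using before_split[of v "A @ [M]" "M # B"] v by (simp add: is_bottom_def AB(2))
    then show "w \<in> {w \<in> states v (Suc h). is_bottom v w}"
      using valley_state[OF AB(1) v] AB(2) by simp
  qed
qed

text \<open>
  An even letter is never a bottom, so the letter before \<open>v\<close> is smaller, and the letter after
  \<open>v\<close> decides between a double ascent and a peak.
\<close>

lemma states_even_double_ascents:
  assumes v: "v = Suc k" "v < M" "even v"
  shows "{w \<in> states v h. \<not> is_top v w} = (\<lambda>(A, B). A @ v # M # B) ` splits (states k h)"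
proof (intro equalityI subsetI)
  fix w assume "w \<in> {w \<in> states v h. \<not> is_top v w}"
  then have w: "w \<in> states v h" "\<not> is_top v w" by auto
  obtain A B where w_eq: "w = A @ v # B"
    using states_max_split[OF w(1)[unfolded v(1)]] v(1) by auto
  note AB = states_at_max[OF w(1)[unfolded w_eq] v(1,2), folded w_eq]
  obtain B' where B: "B = M # B'" using AB(2,12) w(2) by (cases B) auto
  have "A = [] \<or> last A \<in> {1..k}"
    using AB(5,9) v by (auto simp: eo_step_def)
  then have "A @ M # B' \<in> states k h"
    using AB(3,4,7,8) v(1,2) unfolding B states_def
    by (auto simp: successively_append_iff eo_step_def)
  then show "w \<in> (\<lambda>(A, B). A @ v # M # B) ` splits (states k h)"
    using w_eq B by (auto simp: mem_splits intro!: image_eqI[of _ _ "(A, B')"])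
next
  fix w assume "w \<in> (\<lambda>(A, B). A @ v # M # B) ` splits (states k h)"
  then obtain A B where AB: "A @ M # B \<in> states k h" "w = A @ v # M # B"
    by (auto simp: mem_splits)
  have k: "k < M" using v by simp
  have "v \<notin> set A" using states_split_props(1)[OF AB(1) k] v by auto
  then have "\<not> is_top v w"
    using v by (auto simp: is_top_def AB(2) after_split)
  then show "w \<in> {w \<in> states v h. \<not> is_top v w}"
    using double_ascent_state[OF AB(1) v(1,2)] AB(2) by simp
qed

lemma states_even_peaks:
  assumes v: "v = Suc k" "v < M" "even v"
  shows "{w \<in> states v h. is_top v w}
       = (\<lambda>(A, B). A @ v # B) ` {(A, B) \<in> splits (states k (Suc h)). B \<noteq> []}"
proof (intro equalityI subsetI)
  fix w assume "w \<in> {w \<in> states v h. is_top v w}"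
  then have w: "w \<in> states v h" "is_top v w" by auto
  obtain A B where w_eq: "w = A @ v # B"
    using states_max_split[OF w(1)[unfolded v(1)]] v(1) by auto
  note AB = states_at_max[OF w(1)[unfolded w_eq] v(1,2), folded w_eq]
  have "A = [] \<or> last A \<in> {1..k}"
    using AB(5,9) v by (auto simp: eo_step_def)
  moreover have "hd B \<in> {1..k} \<and> odd (hd B)"
    using AB(6,10,12) w(2) by (auto simp: eo_step_def v)
  ultimately have "A @ M # B \<in> states k (Suc h)"
    using AB(2,3,4,7,8) v(1,2) even_M unfolding states_def
    by (auto simp: successively_append_iff successively_Cons eo_step_def)
  then show "w \<in> (\<lambda>(A, B). A @ v # B) ` {(A, B) \<in> splits (states k (Suc h)). B \<noteq> []}"
    using w_eq AB(2) by (auto simp: mem_splits intro!: image_eqI[of _ _ "(A, B)"])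
next
  fix w assume "w \<in> (\<lambda>(A, B). A @ v # B) ` {(A, B) \<in> splits (states k (Suc h)). B \<noteq> []}"
  then obtain A B where AB: "A @ M # B \<in> states k (Suc h)" "w = A @ v # B" "B \<noteq> []"
    by (auto simp: mem_splits)
  have k: "k < M" using v by simp
  note p = states_split_props[OF AB(1) k]
  have "v \<notin> set A" using p(1) v by auto
  then have "is_top v w"
    using p(4) AB(3) v by (auto simp: is_top_def AB(2) after_split)
  then show "w \<in> {w \<in> states v h. is_top v w}"
    using peak_state[OF AB(1) v AB(3)] AB(2) by simp
qed

end
end

section \<open>Weights and the recurrence for weighted sums of words\<close>

context
  fixes a abar b bbar p q y t :: "'a :: comm_ring_1" and M :: nat
begin

text \<open>
  A descent is charged to its bottom, so that \<open>t\<close> is paid when the descent is opened. The factor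
  \<open>y\<close> belongs to the pair \<open>x - 1, x\<close> and is charged to the even letter, which is inserted last.
\<close>

definition letter_wt :: "nat list \<Rightarrow> nat \<Rightarrow> 'a" where
  "letter_wt w x =
     (if \<forall>z \<in> set (before x w). z < x then (if even x then a else abar) else 1)
     * (if \<forall>z \<in> set (after x w). x < z then (if even x then bbar else b) else 1)
     * q ^ straddles x (before x w) * p ^ straddles x (after x w)
     * (if is_bottom x w then t else 1)
     * (if even x \<and> is_top x w \<and> is_bottom (x - 1) w then y else 1)"

definition wt :: "nat \<Rightarrow> nat list \<Rightarrow> 'a" where
  "wt k w = (\<Prod>x\<in>{1..k}. letter_wt w x)"

definition state_sum :: "nat \<Rightarrow> nat \<Rightarrow> 'a" where
  "state_sum k h = (\<Sum>w \<in> states M k h. wt k w)"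

lemma letter_wt_replace:
  assumes "x \<in> set (A @ M # B)" "even x \<Longrightarrow> x - 1 \<in> set (A @ M # B)" "x < M"
    and r: "r \<noteq> []" "\<forall>z\<in>set r. x < z"
  shows "letter_wt (A @ r @ B) x = letter_wt (A @ M # B) x"
proof -
  have "is_bottom (x - 1) (A @ r @ B) = is_bottom (x - 1) (A @ M # B)" if "even x"
    using assms(2)[OF that] assms(3) r by (intro is_bottom_replace) auto
  then show ?thesis
    unfolding letter_wt_def is_top_replace[OF assms(1,3) r] is_bottom_replace[OF assms(1,3) r]
      straddles_before_replace[OF assms(1,3) r] straddles_after_replace[OF assms(1,3) r]
      lr_maximum_replace[OF assms(1,3) r] rl_minimum_replace[OF assms(1,3) r]
    by (cases "even x") simp_all
qed

text \<open>
  The weights of a letter inserted into gap number \<open>i\<close> of \<open>0, \<dots>, h\<close>: there are \<open>i\<close> straddling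
  descents to the left and the remaining ones to the right. A letter joined to the end of block
  \<open>0\<close> becomes a left-to-right maximum, and a letter in the last gap a right-to-left minimum.
  For a peak, \<open>h\<close> counts the joinable gaps that are left after the insertion.
\<close>

definition ascent_wt :: "nat \<Rightarrow> nat \<Rightarrow> nat \<Rightarrow> 'a" where
  "ascent_wt v h i = (if i = 0 then (if even v then a else abar) else 1)
     * (if i = h then (if even v then bbar else b) else 1) * q ^ i * p ^ (h - i)"

definition valley_wt :: "nat \<Rightarrow> nat \<Rightarrow> 'a" where
  "valley_wt h i = (if i = h then b else 1) * q ^ i * p ^ (h - i) * t"

definition peak_wt :: "nat \<Rightarrow> nat \<Rightarrow> 'a" where
  "peak_wt h i = (if i = 0 then a else 1) * q ^ i * p ^ (h - i)"

lemma sum_ascent_wt: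
  "(\<Sum>i<Suc h. ascent_wt v h i)
     = bracket3 p q (if even v then a else abar) (Suc h) (if even v then bbar else b)"
proof (cases h)
  case 0
  then show ?thesis by (simp add: ascent_wt_def bracket3_def)
next
  case (Suc m)
  have "(\<Sum>i<m. ascent_wt v (Suc m) (Suc i)) = (\<Sum>i<m. p ^ (m - i) * q ^ Suc i)"
    by (rule sum.cong) (auto simp: ascent_wt_def)
  moreover have "(\<Sum>i<m. p ^ (m - i) * q ^ Suc i) = (\<Sum>i=1..m. p ^ (Suc m - i) * q ^ i)"
    by (rule sum.reindex_bij_witness[of _ "\<lambda>i. i - 1" Suc]) auto
  moreover have "(\<Sum>i<Suc h. ascent_wt v h i) =
      ascent_wt v h 0 + (\<Sum>i<m. ascent_wt v (Suc m) (Suc i)) + ascent_wt v h h"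
    unfolding Suc by (simp only: sum.lessThan_Suc[of _ "Suc m"] sum.lessThan_Suc_shift[of _ m])
  ultimately show ?thesis
    by (simp add: Suc ascent_wt_def bracket3_def)
qed

lemma sum_peak_wt: "(\<Sum>i<Suc h. peak_wt h i) = bracket2 p q a (Suc h)"
proof -
  have "(\<Sum>i<h. peak_wt h (Suc i)) = (\<Sum>i=1..h. p ^ (h - i) * q ^ i)"
    by (rule sum.reindex_bij_witness[of _ "\<lambda>i. i - 1" Suc]) (auto simp: peak_wt_def mult_ac)
  then show ?thesis
    by (simp add: sum.lessThan_Suc_shift peak_wt_def bracket2_def del: sum.lessThan_Suc)
qed

lemma sum_valley_wt: "(\<Sum>i<Suc h. valley_wt h i) = t * bracket2 q p b (Suc h)"
proof -
  have "(\<Sum>i<h. valley_wt h i) = (\<Sum>i=1..h. t * (q ^ (h - i) * p ^ i))"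
    by (rule sum.reindex_bij_witness[of _ "\<lambda>i. h - i" "\<lambda>i. h - i"])
      (auto simp: valley_wt_def mult_ac)
  then show ?thesis
    by (simp add: valley_wt_def bracket2_def sum_distrib_left algebra_simps)
qed

context
  assumes even_M: "even M"
begin

text \<open>
  The letters present before keep their weights, so the new letter only contributes a factor.
\<close>

lemma wt_insert:
  assumes w: "A @ M # B \<in> states M k h" and v: "v = Suc k" "v < M"
    and r: "r \<noteq> []" "\<forall>z\<in>set r. v \<le> z"
  shows "wt v (A @ r @ B) = wt k (A @ M # B) * letter_wt (A @ r @ B) v"
proof -
  have "letter_wt (A @ r @ B) x = letter_wt (A @ M # B) x" if "x \<in> {1..k}" for x
  proof (rule letter_wt_replace)
    show "x \<in> set (A @ M # B)"
      using states_set[OF even_M w] that by simp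
    show "x - 1 \<in> set (A @ M # B)" if "even x"
    proof -
      have "x - 1 \<in> {1..k}" using that \<open>x \<in> {1..k}\<close> by (cases "x = 1") auto
      then show ?thesis using states_set[OF even_M w] by simp
    qed
  qed (use that v r in auto)
  then show ?thesis
    by (simp add: wt_def v(1) prod.atLeast_Suc_atMost_Suc_shift del: prod.atLeast_Suc_atMost_Suc_shift)
qed

text \<open>
  The number of the gap determines all that the weight of a letter inserted there depends on. The
  last gap is the one with nothing behind it.
\<close>

lemma gap_position:
  assumes w: "A @ M # B \<in> states M k h" and v: "v = Suc k" "v < M"
  shows "straddles v A = count_list A M" "straddles v (M # B) = h - count_list A M"
    "B \<noteq> [] \<Longrightarrow> straddles v B = h - 1 - count_list A M"
    "(\<forall>z\<in>set A. z < v) \<longleftrightarrow> count_list A M = 0"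
    "B = [] \<longleftrightarrow> count_list A M = h"
    "(\<forall>z\<in>set (M # B). v < z) \<longleftrightarrow> count_list A M = h"
    "B \<noteq> [] \<Longrightarrow> \<not> (\<forall>z\<in>set B. v < z)"
    "v \<notin> set A" "A \<noteq> [] \<Longrightarrow> last A < v" "count_list A M \<le> h"
proof -
  have k: "k < M" using v by simp
  note p = states_split_props[OF even_M w k]
  have s: "set A \<subseteq> {..<v} \<union> {M}" "set B \<subseteq> {..<v} \<union> {M}" using p(1,2) v by auto
  have c: "count_list A M + count_list B M = h"
    using states_count[OF even_M w k] by simp
  show "straddles v A = count_list A M"
    by (rule straddles_eq_gaps[OF p(5) s(1) v(2)])
  have "Suc (straddles v (M # B)) = count_list (M # B) M"
    by (rule straddles_eq_gaps_last[OF p(6) _ v(2)]) (use s p(7) in auto)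
  then show "straddles v (M # B) = h - count_list A M" using c by simp
  show "straddles v B = h - 1 - count_list A M" if "B \<noteq> []"
  proof -
    have "Suc (straddles v B) = count_list B M"
      by (rule straddles_eq_gaps_last[OF p(10) s(2) v(2) that]) (use p(7) that in auto)
    then show ?thesis using c by simp
  qed
  show "(\<forall>z\<in>set A. z < v) \<longleftrightarrow> count_list A M = 0"
    using s(1) v(2) by (auto simp: count_list_0_iff)
  have "B = [] \<longleftrightarrow> count_list B M = 0"
    using p(7) last_in_set[of B] by (auto simp: count_list_0_iff split: if_splits)
  then show B: "B = [] \<longleftrightarrow> count_list A M = h" using c by auto
  show nB: "\<not> (\<forall>z\<in>set B. v < z)" if "B \<noteq> []"
    using p(4)[OF that] hd_in_set[OF that] v by force
  show "(\<forall>z\<in>set (M # B). v < z) \<longleftrightarrow> count_list A M = h"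
    using nB B v(2) by auto
  show "v \<notin> set A" using s v by auto
  show "last A < v" if "A \<noteq> []" using p(3)[OF that] v by auto
  show "count_list A M \<le> h" using c by simp
qed

lemma letter_wt_double_ascent:
  assumes w: "A @ M # B \<in> states M k h" and v: "v = Suc k" "v < M"
  shows "letter_wt (A @ v # M # B) v = ascent_wt v h (count_list A M)"
proof -
  note g = gap_position[OF assms]
  have L: "before v (A @ v # M # B) = A" and R: "after v (A @ v # M # B) = M # B"
    using g(8) by (simp_all add: before_split after_split)
  have "\<not> is_bottom v (A @ v # M # B)" "\<not> is_top v (A @ v # M # B)"
    unfolding is_bottom_def is_top_def L R using g(9) v by auto
  then show ?thesis
    unfolding letter_wt_def L R g(1,2,4,6) ascent_wt_def by simp
qed

lemma letter_wt_valley: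
  assumes w: "A @ M # B \<in> states M k h" and v: "v = Suc k" "v < M" "odd v"
  shows "letter_wt (A @ M # v # M # B) v = valley_wt h (count_list A M)"
proof -
  note g = gap_position[OF w v(1,2)]
  have "v \<notin> set (A @ [M])" using g(8) v by simp
  then have L: "before v (A @ M # v # M # B) = A @ [M]" and R: "after v (A @ M # v # M # B) = M # B"
    using before_split[of v "A @ [M]" "M # B"] after_split[of v "A @ [M]" "M # B"] by simp_all
  have "is_bottom v (A @ M # v # M # B)" "\<not> (\<forall>z\<in>set (A @ [M]). z < v)"
    unfolding is_bottom_def L using v by auto
  then show ?thesis
    unfolding letter_wt_def L R g(2,6) valley_wt_def using v g(1) straddles_snoc_gt[OF v(2), of A]
    by simp
qed

text \<open>
  The descent into the block that starts \<open>B\<close> now has \<open>v\<close> itself as its top, so one descent less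
  straddles \<open>v\<close> than the markers suggest.
\<close>

lemma letter_wt_peak:
  assumes w: "A @ M # B \<in> states M k (Suc h)" and v: "v = Suc k" "v < M" "even v" and B: "B \<noteq> []"
  shows "letter_wt (A @ v # B) v
       = peak_wt h (count_list A M) * (if is_bottom k (A @ M # B) then y else 1)"
proof -
  note g = gap_position[OF w v(1,2)]
  have L: "before v (A @ v # B) = A" and R: "after v (A @ v # B) = B"
    using g(8) by (simp_all add: before_split after_split)
  have k: "k < M" "k \<in> {1..k}" using v by (auto intro: Suc_leI odd_pos)
  have "hd B < v" using states_split_props(4)[OF even_M w k(1) B] v by auto
  then have "\<not> is_bottom v (A @ v # B)" "is_top v (A @ v # B)"
    unfolding is_bottom_def is_top_def L R using g(9) v B by auto
  moreover have "is_bottom k (A @ [v] @ B) = is_bottom k (A @ M # B)"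
    using states_set[OF even_M w] k v by (intro is_bottom_replace) auto
  moreover have "straddles v B = h - count_list A M" using g(3)[OF B] by simp
  ultimately show ?thesis
    unfolding letter_wt_def L R g(1,4) peak_wt_def if_not_P[OF g(7)[OF B]] using v by simp
qed

text \<open>
  The weights of the new letter, summed over all gaps of a word, depend only on the number of its
  markers, so the sum over all words factors. The set \<open>T\<close> is arbitrary so that words can
  be restricted by a property of their old letters.
\<close>

lemma sum_double_ascents:
  assumes T: "T \<subseteq> states M k h" and v: "v = Suc k" "v < M"
  shows "(\<Sum>w \<in> (\<lambda>(A, B). A @ v # M # B) ` splits M T. wt v w)
       = (\<Sum>w\<in>T. wt k w)
         * bracket3 p q (if even v then a else abar) (Suc h) (if even v then bbar else b)"
proof -
  have "inj_on (\<lambda>(A, B). A @ v # M # B) (splits M T)"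
  proof (rule inj_on_inverseI[where g = "\<lambda>w. (before v w, tl (after v w))"])
    fix AB assume "AB \<in> splits M T"
    then obtain A B where AB: "AB = (A, B)" "(A, B) \<in> splits M T" by (cases AB) auto
    have "v \<notin> set A" using AB(2) gap_position(8) T v by (auto simp: mem_splits)
    then show "(before v ((\<lambda>(A, B). A @ v # M # B) AB), tl (after v ((\<lambda>(A, B). A @ v # M # B) AB))) = AB"
      by (simp add: AB(1) before_split after_split)
  qed
  then have "(\<Sum>w \<in> (\<lambda>(A, B). A @ v # M # B) ` splits M T. wt v w)
      = (\<Sum>(A, B) \<in> splits M T. wt v (A @ v # M # B))"
    by (subst sum.reindex) (auto intro!: sum.cong)
  also have "\<dots> = (\<Sum>(A, B) \<in> splits M T. wt k (A @ M # B) * ascent_wt v h (count_list A M))"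
  proof (rule sum.cong[OF refl], clarify)
    fix A B assume "(A, B) \<in> splits M T"
    then have "A @ M # B \<in> states M k h" using T by (auto simp: mem_splits)
    then show "wt v (A @ v # M # B) = wt k (A @ M # B) * ascent_wt v h (count_list A M)"
      using wt_insert[of A B k h v "[v, M]"] letter_wt_double_ascent[of A B k h v] v by simp
  qed
  also have "\<dots> = (\<Sum>w\<in>T. wt k w) * (\<Sum>i<Suc h. ascent_wt v h i)"
    by (rule sum_splits)
      (use T v states_count[OF even_M] finite_subset[OF T finite_states[OF even_M]] in auto)
  finally show ?thesis by (simp only: sum_ascent_wt)
qed

lemma sum_valleys:
  assumes T: "T \<subseteq> states M k h" and v: "v = Suc k" "v < M" "odd v"
  shows "(\<Sum>w \<in> (\<lambda>(A, B). A @ M # v # M # B) ` splits M T. wt v w)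
       = (\<Sum>w\<in>T. wt k w) * (t * bracket2 q p b (Suc h))"
proof -
  have "inj_on (\<lambda>(A, B). A @ M # v # M # B) (splits M T)"
  proof (rule inj_on_inverseI[where g = "\<lambda>w. (butlast (before v w), tl (after v w))"])
    fix AB assume "AB \<in> splits M T"
    then obtain A B where AB: "AB = (A, B)" "(A, B) \<in> splits M T" by (cases AB) auto
    have "v \<notin> set (A @ [M])" using AB(2) gap_position(8) T v by (auto simp: mem_splits)
    then show "(butlast (before v ((\<lambda>(A, B). A @ M # v # M # B) AB)), tl (after v ((\<lambda>(A, B). A @ M # v # M # B) AB))) = AB"
      using before_split[of v "A @ [M]" "M # B"] after_split[of v "A @ [M]" "M # B"] by (simp add: AB(1))
  qed
  then have "(\<Sum>w \<in> (\<lambda>(A, B). A @ M # v # M # B) ` splits M T. wt v w)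
      = (\<Sum>(A, B) \<in> splits M T. wt v (A @ M # v # M # B))"
    by (subst sum.reindex) (auto intro!: sum.cong)
  also have "\<dots> = (\<Sum>(A, B) \<in> splits M T. wt k (A @ M # B) * valley_wt h (count_list A M))"
  proof (rule sum.cong[OF refl], clarify)
    fix A B assume "(A, B) \<in> splits M T"
    then have "A @ M # B \<in> states M k h" using T by (auto simp: mem_splits)
    then show "wt v (A @ M # v # M # B) = wt k (A @ M # B) * valley_wt h (count_list A M)"
      using wt_insert[of A B k h v "[M, v, M]"] letter_wt_valley[of A B k h v] v by simp
  qed
  also have "\<dots> = (\<Sum>w\<in>T. wt k w) * (\<Sum>i<Suc h. valley_wt h i)"
    by (rule sum_splits)
      (use T v states_count[OF even_M] finite_subset[OF T finite_states[OF even_M]] in auto)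
  finally show ?thesis by (simp only: sum_valley_wt)
qed

text \<open>
  For a peak the old word contributes more than its number of markers: if its largest letter \<open>k\<close> is
  a bottom, the new top completes the pair that \<open>y\<close> counts. The last gap cannot be filled up.
\<close>

lemma sum_peaks:
  assumes v: "v = Suc k" "v < M" "even v"
  shows "(\<Sum>w \<in> (\<lambda>(A, B). A @ v # B) ` {(A, B) \<in> splits M (states M k (Suc h)). B \<noteq> []}. wt v w)
       = (\<Sum>w \<in> states M k (Suc h). wt k w * (if is_bottom k w then y else 1))
         * bracket2 p q a (Suc h)"
proof -
  let ?T = "states M k (Suc h)"
  let ?g = "\<lambda>w. wt k w * (if is_bottom k w then y else 1)"
  \<comment> \<open>Weight \<open>0\<close> at the last gap extends the sum from peaks to all gaps.\<close>
  let ?f = "\<lambda>i. if i = Suc h then 0 else peak_wt h i"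
  have fin: "finite (splits M ?T)" by (intro finite_splits finite_states even_M)
  have "inj_on (\<lambda>(A, B). A @ v # B) {(A, B) \<in> splits M ?T. B \<noteq> []}"
  proof (rule inj_on_inverseI[where g = "\<lambda>w. (before v w, after v w)"])
    fix AB assume "AB \<in> {(A, B) \<in> splits M ?T. B \<noteq> []}"
    then obtain A B where AB: "AB = (A, B)" "(A, B) \<in> splits M ?T" by auto
    have "v \<notin> set A" using AB(2) gap_position(8) v by (auto simp: mem_splits)
    then show "(before v ((\<lambda>(A, B). A @ v # B) AB), after v ((\<lambda>(A, B). A @ v # B) AB)) = AB"
      by (simp add: AB(1) before_split after_split)
  qed
  then have "(\<Sum>w \<in> (\<lambda>(A, B). A @ v # B) ` {(A, B) \<in> splits M ?T. B \<noteq> []}. wt v w)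
      = (\<Sum>(A, B) \<in> {(A, B) \<in> splits M ?T. B \<noteq> []}. wt v (A @ v # B))"
    by (subst sum.reindex) (auto intro!: sum.cong)
  also have "\<dots> = (\<Sum>(A, B) \<in> splits M ?T. ?g (A @ M # B) * ?f (count_list A M))"
  proof (rule sum.mono_neutral_cong_left[OF fin])
    show "\<forall>AB \<in> splits M ?T - {(A, B) \<in> splits M ?T. B \<noteq> []}.
        (case AB of (A, B) \<Rightarrow> ?g (A @ M # B) * ?f (count_list A M)) = 0"
      using gap_position(5)[of _ "[]" k "Suc h" v] v by (auto simp: mem_splits)
  next
    fix AB assume "AB \<in> {(A, B) \<in> splits M ?T. B \<noteq> []}"
    then obtain A B where AB: "AB = (A, B)" "A @ M # B \<in> ?T" "B \<noteq> []"
      by (auto simp: mem_splits)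
    have "count_list A M \<noteq> Suc h" using gap_position(5)[OF AB(2) v(1,2)] AB(3) by simp
    then show "(case AB of (A, B) \<Rightarrow> wt v (A @ v # B))
        = (case AB of (A, B) \<Rightarrow> ?g (A @ M # B) * ?f (count_list A M))"
      using wt_insert[OF AB(2) v(1,2), of "[v]"] letter_wt_peak[OF AB(2) v AB(3)]
      by (simp add: AB(1) mult_ac)
  qed blast
  also have "\<dots> = (\<Sum>w\<in>?T. ?g w) * (\<Sum>i<Suc (Suc h). ?f i)"
    by (rule sum_splits)
      (use v states_count[OF even_M] finite_states[OF even_M] in auto)
  also have "(\<Sum>i<Suc (Suc h). ?f i) = (\<Sum>i<Suc h. peak_wt h i)"
    by simp
  finally show ?thesis by (simp only: sum_peak_wt)
qed

lemma sum_states_split: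
  "(\<Sum>w \<in> states M k h. f w)
     = (\<Sum>w \<in> {w \<in> states M k h. \<not> P w}. f w) + (\<Sum>w \<in> {w \<in> states M k h. P w}. f w)"
  for f :: "nat list \<Rightarrow> 'a"
  by (subst sum.union_disjoint[symmetric]) (auto intro!: sum.cong simp: finite_states[OF even_M])

lemma state_sum_0: "state_sum 0 h = (if h = 0 then 1 else 0)"
  by (simp add: state_sum_def states_0[OF even_M] wt_def)

text \<open>
  An odd letter followed by an even one. The height stays the same through two double ascents or
  through a valley and a peak, and only the latter pair earns \<open>y\<close>; it rises through a valley and a
  double ascent and falls through a double ascent and a peak. Odd double ascents and
  odd valleys have to be summed separately since the weight of the peak distinguishes them.
\<close>

lemma state_sum_step:
  assumes "even k" "k + 2 < M"
  shows "state_sum (k + 2) h =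
      state_sum k h * (bracket3 p q abar (Suc h) b * bracket3 p q a (Suc h) bbar
                       + t * y * bracket2 p q a (Suc h) * bracket2 q p b (Suc h))
    + (if h = 0 then 0 else
        state_sum k (h - 1) * (t * bracket2 q p b h * bracket3 p q a (Suc h) bbar))
    + state_sum k (Suc h) * (bracket3 p q abar (Suc (Suc h)) b * bracket2 p q a (Suc h))"
proof -
  define v where "v = Suc k"
  have v: "v = Suc k" "v < M" "odd v" and v': "k + 2 = Suc v" "Suc v < M" "even (Suc v)"
    using assms by (auto simp: v_def)
  let ?asc = "\<lambda>h. (\<Sum>w \<in> {w \<in> states M v h. \<not> is_bottom v w}. wt v w)"
  let ?val = "\<lambda>h. (\<Sum>w \<in> {w \<in> states M v h. is_bottom v w}. wt v w)"
  have asc: "?asc h = state_sum k h * bracket3 p q abar (Suc h) b" for h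
    using sum_double_ascents[OF subset_refl v(1,2)] v(3)
    by (simp add: states_odd_double_ascents[OF even_M v] state_sum_def)
  have val: "?val (Suc h) = state_sum k h * (t * bracket2 q p b (Suc h))" for h
    using sum_valleys[OF subset_refl v]
    by (simp add: states_odd_valleys(1)[OF even_M v] state_sum_def)
  have val0: "?val 0 = 0"
    by (simp add: states_odd_valleys(2)[OF even_M v])
  have odd: "state_sum v h = ?asc h + ?val h" for h
    unfolding state_sum_def by (rule sum_states_split)
  have y: "(\<Sum>w \<in> states M v h. wt v w * (if is_bottom v w then y else 1)) = ?asc h + y * ?val h" for h
    by (subst sum_states_split[where P = "is_bottom v"]) (simp add: sum_distrib_left mult_ac)
  have "state_sum (Suc v) h = (\<Sum>w \<in> {w \<in> states M (Suc v) h. \<not> is_top (Suc v) w}. wt (Suc v) w)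
      + (\<Sum>w \<in> {w \<in> states M (Suc v) h. is_top (Suc v) w}. wt (Suc v) w)"
    unfolding state_sum_def by (rule sum_states_split)
  also have "\<dots> = state_sum v h * bracket3 p q a (Suc h) bbar
      + (?asc (Suc h) + y * ?val (Suc h)) * bracket2 p q a (Suc h)"
    using sum_double_ascents[OF subset_refl refl v'(2), of h] sum_peaks[OF refl v'(2,3), of h] v'(3)
    by (simp add: states_even_double_ascents[OF even_M refl v'(2,3)]
        states_even_peaks[OF even_M refl v'(2,3)] state_sum_def y)
  finally show ?thesis
    unfolding v' odd asc val
    by (cases h) (simp_all add: val val0 algebra_simps)
qed

end
end

section \<open>Permutations as words without inner gaps\<close>

definition word :: "nat \<Rightarrow> (nat \<Rightarrow> nat) \<Rightarrow> nat list" where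
  "word m \<sigma> = map \<sigma> [1..<Suc m]"

lemma straddles_snoc:
  "straddles x (w @ [c]) = straddles x w + (if w \<noteq> [] \<and> c < x \<and> x < last w then 1 else 0)"
  by (induction x w rule: straddles.induct) auto

lemma straddles_map_upt:
  "straddles x (map \<sigma> [r..<s]) = card {l. r < l \<and> l < s \<and> x < \<sigma> (l - 1) \<and> \<sigma> l < x}"
proof (induction s)
  case 0
  then show ?case by simp
next
  case (Suc s)
  let ?S = "\<lambda>s. {l. r < l \<and> l < s \<and> x < \<sigma> (l - 1) \<and> \<sigma> l < x}"
  show ?case
  proof (cases "r < s")
    case True
    have fin: "finite (?S s)" by (rule finite_subset[of _ "{..<s}"]) auto
    have "?S (Suc s) = (if \<sigma> s < x \<and> x < \<sigma> (s - 1) then insert s (?S s) else ?S s)"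
      using True by (auto simp: less_Suc_eq)
    moreover have "last (map \<sigma> [r..<s]) = \<sigma> (s - 1)"
      using True by (simp add: last_map)
    ultimately show ?thesis
      using True Suc fin by (simp add: straddles_snoc)
  next
    case False
    then have "?S (Suc s) = {}" by auto
    moreover have "straddles x (map \<sigma> [r..<Suc s]) = 0" using False by (cases "r = s") auto
    ultimately show ?thesis by simp
  qed
qed

lemma
  assumes \<sigma>: "\<sigma> permutes {1..m}" and i: "i \<in> {1..m}"
  shows before_word: "before (\<sigma> i) (word m \<sigma> @ [M]) = map \<sigma> [1..<i]"
    and after_word: "after (\<sigma> i) (word m \<sigma> @ [M]) = map \<sigma> [Suc i..<Suc m] @ [M]"
proof -
  have "[1..<Suc m] = [1..<i] @ i # [Suc i..<Suc m]"
    using i upt_add_eq_append[of 1 i "Suc m - i"] upt_conv_Cons[of i "Suc m"]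
    by (simp del: upt_Suc)
  then have w: "word m \<sigma> @ [M] = map \<sigma> [1..<i] @ \<sigma> i # (map \<sigma> [Suc i..<Suc m] @ [M])"
    by (simp add: word_def)
  have n: "\<sigma> i \<notin> set (map \<sigma> [1..<i])"
    by (auto simp: inj_eq[OF permutes_inj[OF \<sigma>]])
  show "before (\<sigma> i) (word m \<sigma> @ [M]) = map \<sigma> [1..<i]"
    unfolding w by (rule before_split[OF n])
  show "after (\<sigma> i) (word m \<sigma> @ [M]) = map \<sigma> [Suc i..<Suc m] @ [M]"
    unfolding w by (rule after_split[OF n])
qed

lemma permutes_atLeastAtMost_cases:
  assumes "\<sigma> permutes {1..m}" "x \<in> {1..m}"
  obtains i where "i \<in> {1..m}" "x = \<sigma> i"
  using assms permutes_image[OF assms(1)] by (metis imageE)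

lemma is_bottom_word:
  assumes \<sigma>: "\<sigma> permutes {1..m}" and x: "x \<in> {1..m}"
  shows "is_bottom x (word m \<sigma> @ [M]) \<longleftrightarrow> x \<in> descent_bottoms m \<sigma>"
proof -
  obtain i where i: "i \<in> {1..m}" "x = \<sigma> i" using permutes_atLeastAtMost_cases assms by metis
  have "is_bottom x (word m \<sigma> @ [M]) \<longleftrightarrow> 1 < i \<and> \<sigma> i < \<sigma> (i - 1)"
    unfolding is_bottom_def i(2) before_word[OF \<sigma> i(1)] using i(1)
    by (cases i) (auto simp: last_map)
  also have "\<dots> \<longleftrightarrow> x \<in> descent_bottoms m \<sigma>"
  proof
    assume "1 < i \<and> \<sigma> i < \<sigma> (i - 1)"
    then have "(\<sigma> (i - 1), \<sigma> i) \<in> descents m \<sigma>"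
      using i(1) unfolding descents_def by (auto intro!: exI[of _ "i - 1"])
    then show "x \<in> descent_bottoms m \<sigma>" unfolding descent_bottoms_def i(2) by force
  next
    assume "x \<in> descent_bottoms m \<sigma>"
    then obtain j where "\<sigma> i = \<sigma> (j + 1)" "1 \<le> j" "\<sigma> (j + 1) < \<sigma> j"
      by (auto simp: descent_bottoms_def descents_def i(2))
    moreover from this have "i = j + 1" by (simp add: inj_eq[OF permutes_inj[OF \<sigma>]])
    ultimately show "1 < i \<and> \<sigma> i < \<sigma> (i - 1)" by simp
  qed
  finally show ?thesis .
qed

lemma is_top_word:
  assumes \<sigma>: "\<sigma> permutes {1..m}" and x: "x \<in> {1..m}" and M: "m < M"
  shows "is_top x (word m \<sigma> @ [M]) \<longleftrightarrow> x \<in> descent_tops m \<sigma>"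
proof -
  obtain i where i: "i \<in> {1..m}" "x = \<sigma> i" using permutes_atLeastAtMost_cases assms by metis
  have "hd (map \<sigma> [Suc i..<Suc m] @ [M]) = (if i < m then \<sigma> (Suc i) else M)"
    using i(1) by (simp add: upt_conv_Cons del: upt_Suc)
  then have "is_top x (word m \<sigma> @ [M]) \<longleftrightarrow> i < m \<and> \<sigma> (i + 1) < \<sigma> i"
    unfolding is_top_def i(2) after_word[OF \<sigma> i(1)] using x M i(2) by auto
  also have "\<dots> \<longleftrightarrow> x \<in> descent_tops m \<sigma>"
  proof
    assume "i < m \<and> \<sigma> (i + 1) < \<sigma> i"
    then have "(\<sigma> i, \<sigma> (i + 1)) \<in> descents m \<sigma>"
      using i(1) unfolding descents_def by auto
    then show "x \<in> descent_tops m \<sigma>" unfolding descent_tops_def i(2) by force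
  next
    assume "x \<in> descent_tops m \<sigma>"
    then obtain j where "\<sigma> i = \<sigma> j" "j < m" "\<sigma> (j + 1) < \<sigma> j"
      by (auto simp: descent_tops_def descents_def i(2))
    moreover from this have "i = j" by (simp add: inj_eq[OF permutes_inj[OF \<sigma>]])
    ultimately show "i < m \<and> \<sigma> (i + 1) < \<sigma> i" by simp
  qed
  finally show ?thesis .
qed

lemma lr_maximum_word:
  assumes \<sigma>: "\<sigma> permutes {1..m}" and x: "x \<in> {1..m}"
  shows "(\<forall>z \<in> set (before x (word m \<sigma> @ [M])). z < x) \<longleftrightarrow> x \<in> lr_maxima m \<sigma>"
proof -
  obtain i where i: "i \<in> {1..m}" "x = \<sigma> i" using permutes_atLeastAtMost_cases assms by metis
  have "\<sigma> i = \<sigma> i' \<longleftrightarrow> i = i'" for i' by (auto simp: inj_eq[OF permutes_inj[OF \<sigma>]])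
  then have "x \<in> lr_maxima m \<sigma> \<longleftrightarrow> (\<forall>j \<in> {1..m}. j < i \<longrightarrow> \<sigma> j < \<sigma> i)"
    using i(1) by (auto simp: lr_maxima_def i(2))
  also have "\<dots> \<longleftrightarrow> (\<forall>z \<in> set (before x (word m \<sigma> @ [M])). z < x)"
    unfolding i(2) before_word[OF \<sigma> i(1)] using i(1) by auto
  finally show ?thesis by simp
qed

lemma rl_minimum_word:
  assumes \<sigma>: "\<sigma> permutes {1..m}" and x: "x \<in> {1..m}" and M: "m < M"
  shows "(\<forall>z \<in> set (after x (word m \<sigma> @ [M])). x < z) \<longleftrightarrow> x \<in> rl_minima m \<sigma>"
proof -
  obtain i where i: "i \<in> {1..m}" "x = \<sigma> i" using permutes_atLeastAtMost_cases assms by metis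
  have "\<sigma> i = \<sigma> i' \<longleftrightarrow> i = i'" for i' by (auto simp: inj_eq[OF permutes_inj[OF \<sigma>]])
  then have "x \<in> rl_minima m \<sigma> \<longleftrightarrow> (\<forall>j \<in> {1..m}. j > i \<longrightarrow> \<sigma> i < \<sigma> j)"
    using i(1) by (auto simp: rl_minima_def i(2))
  also have "\<dots> \<longleftrightarrow> (\<forall>z \<in> set (after x (word m \<sigma> @ [M])). x < z)"
    unfolding i(2) after_word[OF \<sigma> i(1)] using i x M by (auto simp del: upt_Suc)
  finally show ?thesis by simp
qed

text \<open>
  Each pattern occurrence is determined by its letter 2 and the descent straddling it.
\<close>

lemma sum_straddles_before_word:
  assumes \<sigma>: "\<sigma> permutes {1..m}"
  shows "(\<Sum>x\<in>{1..m}. straddles x (before x (word m \<sigma> @ [M]))) = pat_31_2 m \<sigma>"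
proof -
  let ?S = "\<lambda>j. {l. 1 < l \<and> l < j \<and> \<sigma> j < \<sigma> (l - 1) \<and> \<sigma> l < \<sigma> j}"
  have fin: "finite (?S j)" for j by (rule finite_subset[of _ "{..<j}"]) auto
  have "(\<Sum>x\<in>{1..m}. straddles x (before x (word m \<sigma> @ [M]))) = (\<Sum>j\<in>{1..m}. card (?S j))"
    unfolding sum.permute[OF \<sigma>, of "\<lambda>x. straddles x (before x (word m \<sigma> @ [M]))"]
    by (intro sum.cong refl) (simp only: o_def before_word[OF \<sigma>] straddles_map_upt)
  also have "\<dots> = card (Sigma {1..m} ?S)"
    using fin by simp
  also have "\<dots> = card (prod.swap ` Sigma {1..m} ?S)"
    by (simp add: card_image)
  also have "prod.swap ` Sigma {1..m} ?S
      = {(i, j). 2 \<le> i \<and> i < j \<and> j \<le> m \<and> \<sigma> (i - 1) > \<sigma> j \<and> \<sigma> j > \<sigma> i}"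
    by (auto simp: image_iff)
  finally show ?thesis by (simp add: pat_31_2_def)
qed

lemma sum_straddles_after_word:
  assumes \<sigma>: "\<sigma> permutes {1..m}" and M: "m < M"
  shows "(\<Sum>x\<in>{1..m}. straddles x (after x (word m \<sigma> @ [M]))) = pat_2_31 m \<sigma>"
proof -
  let ?S = "\<lambda>i. {l. Suc i < l \<and> l < Suc m \<and> \<sigma> i < \<sigma> (l - 1) \<and> \<sigma> l < \<sigma> i}"
  have fin: "finite (?S i)" for i by (rule finite_subset[of _ "{..<Suc m}"]) auto
  have lt: "\<sigma> i < M" if "i \<in> {1..m}" for i
    using permutes_in_image[OF \<sigma>, of i] that M by auto
  have "(\<Sum>x\<in>{1..m}. straddles x (after x (word m \<sigma> @ [M]))) = (\<Sum>i\<in>{1..m}. card (?S i))"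
    unfolding sum.permute[OF \<sigma>, of "\<lambda>x. straddles x (after x (word m \<sigma> @ [M]))"]
    by (intro sum.cong refl)
      (simp only: o_def after_word[OF \<sigma>] straddles_snoc_gt[OF lt] straddles_map_upt)
  also have "\<dots> = card (Sigma {1..m} ?S)"
    using fin by simp
  \<comment> \<open>The pattern is indexed by the position of the descent top, \<open>straddles\<close> by that of the bottom.\<close>
  also have "\<dots> = card ((\<lambda>(i, l). (i, l - 1)) ` Sigma {1..m} ?S)"
    by (rule card_image[symmetric]) (auto simp: inj_on_def)
  also have "(\<lambda>(i, l). (i, l - 1)) ` Sigma {1..m} ?S
      = {(i, j). 1 \<le> i \<and> i < j \<and> j \<le> m - 1 \<and> \<sigma> j > \<sigma> i \<and> \<sigma> i > \<sigma> (j + 1)}"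
    (is "?L = ?R")
  proof (intro equalityI subsetI)
    fix z assume "z \<in> ?R"
    then obtain i j where z: "z = (i, j)"
      and ij: "1 \<le> i" "i < j" "j \<le> m - 1" "\<sigma> j > \<sigma> i" "\<sigma> i > \<sigma> (j + 1)" by auto
    have "i \<le> m" "j < m" using ij(1,2,3) by linarith+
    then have "z = (i, j)" "(i, Suc j) \<in> Sigma {1..m} ?S" using z ij by auto
    then show "z \<in> ?L" by (auto intro!: image_eqI[of _ _ "(i, Suc j)"])
  qed auto
  finally show ?thesis by (simp add: pat_2_31_def)
qed

lemma des_eq_card_bottoms:
  assumes \<sigma>: "\<sigma> permutes {1..m}"
  shows "des m \<sigma> = card {x \<in> {1..m}. x \<in> descent_bottoms m \<sigma>}"
proof -
  have "inj_on snd (descents m \<sigma>)"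
    by (auto simp: inj_on_def descents_def inj_eq[OF permutes_inj[OF \<sigma>]])
  moreover have "descent_bottoms m \<sigma> \<subseteq> {1..m}"
  proof
    fix x assume "x \<in> descent_bottoms m \<sigma>"
    then obtain i where "x = \<sigma> (i + 1)" "i + 1 \<in> {1..m}"
      by (auto simp: descent_bottoms_def descents_def)
    then show "x \<in> {1..m}" using permutes_in_image[OF \<sigma>, of "i + 1"] by simp
  qed
  then have "{x \<in> {1..m}. x \<in> descent_bottoms m \<sigma>} = snd ` descents m \<sigma>"
    by (auto simp: descent_bottoms_def)
  ultimately show ?thesis by (simp add: des_def card_image)
qed

lemma prod_if_one:
  fixes c :: "'a :: comm_monoid_mult"
  shows "finite A \<Longrightarrow> (\<Prod>x\<in>A. if P x then c else 1) = c ^ card {x \<in> A. P x}"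
  by (simp add: prod.inter_filter[symmetric])

lemma dom_stat_eq_card:
  "dom_stat n \<sigma> = card {x \<in> {1..2 * n}. even x \<and> x \<in> descent_tops (2 * n) \<sigma>
                                          \<and> x - 1 \<in> descent_bottoms (2 * n) \<sigma>}"
proof -
  have "{x \<in> {1..2 * n}. even x \<and> x \<in> descent_tops (2 * n) \<sigma> \<and> x - 1 \<in> descent_bottoms (2 * n) \<sigma>}
    = (\<lambda>j. 2 * j) ` {j \<in> {1..n}. 2 * j \<in> descent_tops (2 * n) \<sigma>
                                   \<and> 2 * j - 1 \<in> descent_bottoms (2 * n) \<sigma>}"
    by (auto elim!: evenE simp: image_iff)
  then show ?thesis by (simp add: dom_stat_def card_image inj_on_def)
qed

lemma lr_maxima_subset: "\<sigma> permutes {1..m} \<Longrightarrow> lr_maxima m \<sigma> \<subseteq> {1..m}"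
  using permutes_in_image by (fastforce simp: lr_maxima_def)

lemma rl_minima_subset: "\<sigma> permutes {1..m} \<Longrightarrow> rl_minima m \<sigma> \<subseteq> {1..m}"
  using permutes_in_image by (fastforce simp: rl_minima_def)

text \<open>
  The statistics are numbers of letters or sums over letters, so their powers are products over
  letters. Both pattern statistics run over the letter that plays the role of 2.
\<close>

lemma wt_word:
  fixes a :: "'a :: comm_ring_1"
  assumes \<sigma>: "\<sigma> permutes {1..2 * n}" and M: "2 * n < M"
  shows "wt a abar b bbar p q y t (2 * n) (word (2 * n) \<sigma> @ [M]) =
        a ^ lema (2 * n) \<sigma> * abar ^ loma (2 * n) \<sigma> *
        b ^ romi (2 * n) \<sigma> * bbar ^ remi (2 * n) \<sigma> *
        p ^ pat_2_31 (2 * n) \<sigma> * q ^ pat_31_2 (2 * n) \<sigma> *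
        y ^ dom_stat n \<sigma> * t ^ des (2 * n) \<sigma>"
proof -
  let ?w = "word (2 * n) \<sigma> @ [M]" and ?I = "{1..2 * n}"
  have "letter_wt a abar b bbar p q y t ?w x =
      (if even x \<and> x \<in> lr_maxima (2 * n) \<sigma> then a else 1)
    * (if odd x \<and> x \<in> lr_maxima (2 * n) \<sigma> then abar else 1)
    * (if odd x \<and> x \<in> rl_minima (2 * n) \<sigma> then b else 1)
    * (if even x \<and> x \<in> rl_minima (2 * n) \<sigma> then bbar else 1)
    * p ^ straddles x (after x ?w) * q ^ straddles x (before x ?w)
    * (if even x \<and> x \<in> descent_tops (2 * n) \<sigma> \<and> x - 1 \<in> descent_bottoms (2 * n) \<sigma> then y else 1)
    * (if x \<in> descent_bottoms (2 * n) \<sigma> then t else 1)" if x: "x \<in> ?I" for x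
  proof -
    have "is_bottom (x - 1) ?w \<longleftrightarrow> x - 1 \<in> descent_bottoms (2 * n) \<sigma>" if "even x"
      using x that by (intro is_bottom_word[OF \<sigma>]) (cases "x = 1"; auto)
    then show ?thesis
      unfolding letter_wt_def lr_maximum_word[OF \<sigma> x] rl_minimum_word[OF \<sigma> x M]
        is_bottom_word[OF \<sigma> x] is_top_word[OF \<sigma> x M]
      by (cases "even x") (simp_all add: mult_ac)
  qed
  then have "wt a abar b bbar p q y t (2 * n) ?w =
      (\<Prod>x\<in>?I. if even x \<and> x \<in> lr_maxima (2 * n) \<sigma> then a else 1)
    * (\<Prod>x\<in>?I. if odd x \<and> x \<in> lr_maxima (2 * n) \<sigma> then abar else 1)
    * (\<Prod>x\<in>?I. if odd x \<and> x \<in> rl_minima (2 * n) \<sigma> then b else 1)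
    * (\<Prod>x\<in>?I. if even x \<and> x \<in> rl_minima (2 * n) \<sigma> then bbar else 1)
    * (\<Prod>x\<in>?I. p ^ straddles x (after x ?w)) * (\<Prod>x\<in>?I. q ^ straddles x (before x ?w))
    * (\<Prod>x\<in>?I. if even x \<and> x \<in> descent_tops (2 * n) \<sigma>
                       \<and> x - 1 \<in> descent_bottoms (2 * n) \<sigma> then y else 1)
    * (\<Prod>x\<in>?I. if x \<in> descent_bottoms (2 * n) \<sigma> then t else 1)"
    unfolding wt_def prod.distrib[symmetric] by (rule prod.cong[OF refl])
  also have "\<dots> = a ^ card {x \<in> ?I. even x \<and> x \<in> lr_maxima (2 * n) \<sigma>}
    * abar ^ card {x \<in> ?I. odd x \<and> x \<in> lr_maxima (2 * n) \<sigma>}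
    * b ^ card {x \<in> ?I. odd x \<and> x \<in> rl_minima (2 * n) \<sigma>}
    * bbar ^ card {x \<in> ?I. even x \<and> x \<in> rl_minima (2 * n) \<sigma>}
    * p ^ pat_2_31 (2 * n) \<sigma> * q ^ pat_31_2 (2 * n) \<sigma>
    * y ^ dom_stat n \<sigma> * t ^ des (2 * n) \<sigma>"
    unfolding prod_if_one[OF finite_atLeastAtMost] power_sum[symmetric]
      sum_straddles_before_word[OF \<sigma>] sum_straddles_after_word[OF \<sigma> M]
      des_eq_card_bottoms[OF \<sigma>] dom_stat_eq_card ..
  also have "{x \<in> ?I. even x \<and> x \<in> lr_maxima (2 * n) \<sigma>} = {x \<in> lr_maxima (2 * n) \<sigma>. even x}"
    using lr_maxima_subset[OF \<sigma>] by auto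
  also have "{x \<in> ?I. odd x \<and> x \<in> lr_maxima (2 * n) \<sigma>} = {x \<in> lr_maxima (2 * n) \<sigma>. odd x}"
    using lr_maxima_subset[OF \<sigma>] by auto
  also have "{x \<in> ?I. odd x \<and> x \<in> rl_minima (2 * n) \<sigma>} = {x \<in> rl_minima (2 * n) \<sigma>. odd x}"
    using rl_minima_subset[OF \<sigma>] by auto
  also have "{x \<in> ?I. even x \<and> x \<in> rl_minima (2 * n) \<sigma>} = {x \<in> rl_minima (2 * n) \<sigma>. even x}"
    using rl_minima_subset[OF \<sigma>] by auto
  finally show ?thesis
    by (simp add: lema_def loma_def remi_def romi_def)
qed

lemma successively_word:
  "successively eo_step (word m \<sigma>)
     \<longleftrightarrow> (\<forall>i. 1 \<le> i \<longrightarrow> i < m \<longrightarrow> eo_step (\<sigma> i) (\<sigma> (i + 1)))"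
proof (induction m)
  case (Suc m)
  have w: "word (Suc m) \<sigma> = word m \<sigma> @ [\<sigma> (Suc m)]" by (simp add: word_def)
  have "word m \<sigma> = [] \<longleftrightarrow> m = 0" "m \<noteq> 0 \<Longrightarrow> last (word m \<sigma>) = \<sigma> m"
    by (auto simp: word_def last_map)
  then show ?case
    using Suc unfolding w by (cases "m = 0") (auto simp: successively_append_iff less_Suc_eq Suc_le_eq)
qed (simp add: word_def)

lemma even_odd_perms_iff:
  "\<sigma> \<in> even_odd_perms n \<longleftrightarrow> \<sigma> permutes {1..2 * n} \<and> successively eo_step (word (2 * n) \<sigma>)"
proof -
  have "(\<forall>(u, v) \<in> descents (2 * n) \<sigma>. even u \<and> odd v)
      \<longleftrightarrow> (\<forall>i. 1 \<le> i \<longrightarrow> i < 2 * n \<longrightarrow> eo_step (\<sigma> i) (\<sigma> (i + 1)))" if "\<sigma> permutes {1..2 * n}"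
  proof -
    have "\<sigma> i \<noteq> \<sigma> (i + 1)" for i by (simp add: inj_eq[OF permutes_inj[OF that]])
    then have "eo_step (\<sigma> i) (\<sigma> (i + 1))
        \<longleftrightarrow> (\<sigma> (i + 1) < \<sigma> i \<longrightarrow> even (\<sigma> i) \<and> odd (\<sigma> (i + 1)))" for i
      unfolding eo_step_def by (metis less_asym linorder_neqE_nat)
    then show ?thesis unfolding descents_def by auto
  qed
  then show ?thesis by (auto simp: even_odd_perms_def successively_word)
qed

text \<open>
  Once all letters are inserted and only the final marker is left, the word is a permutation.
\<close>

lemma bij_betw_word_states:
  assumes M: "even M" "2 * n < M"
  shows "bij_betw (\<lambda>\<sigma>. word (2 * n) \<sigma> @ [M]) (even_odd_perms n) (states M (2 * n) 0)"
proof (rule bij_betw_imageI)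
  let ?m = "2 * n"
  show "inj_on (\<lambda>\<sigma>. word ?m \<sigma> @ [M]) (even_odd_perms n)"
  proof (rule inj_onI)
    fix \<sigma> \<tau> assume "\<sigma> \<in> even_odd_perms n" "\<tau> \<in> even_odd_perms n"
      and eq: "word ?m \<sigma> @ [M] = word ?m \<tau> @ [M]"
    then have p: "\<sigma> permutes {1..?m}" "\<tau> permutes {1..?m}" by (auto simp: even_odd_perms_def)
    have "\<sigma> i = \<tau> i" if "i \<in> {1..?m}" for i
      using eq that by (auto simp: word_def simp del: upt_Suc)
    then show "\<sigma> = \<tau>"
      using p by (metis ext permutes_not_in)
  qed
  show "(\<lambda>\<sigma>. word ?m \<sigma> @ [M]) ` even_odd_perms n = states M ?m 0"
  proof (intro equalityI subsetI)
    fix w assume "w \<in> (\<lambda>\<sigma>. word ?m \<sigma> @ [M]) ` even_odd_perms n"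
    then obtain \<sigma> where \<sigma>: "\<sigma> permutes {1..?m}" "successively eo_step (word ?m \<sigma>)"
      and w: "w = word ?m \<sigma> @ [M]" by (auto simp: even_odd_perms_iff)
    have s: "set (word ?m \<sigma>) = {1..?m}"
      unfolding word_def using permutes_image[OF \<sigma>(1)]
      by (simp add: atLeastLessThanSuc_atLeastAtMost del: upt_Suc)
    moreover have "distinct (word ?m \<sigma>)"
      unfolding word_def by (simp add: distinct_map permutes_inj_on[OF \<sigma>(1)] del: upt_Suc)
    ultimately have "mset (word ?m \<sigma>) = mset_set {1..?m}"
      by (metis mset_set_set)
    moreover have "eo_step (last (word ?m \<sigma>)) M" if "word ?m \<sigma> \<noteq> []"
      using last_in_set[OF that] M unfolding s eo_step_def by simp
    ultimately show "w \<in> states M ?m 0"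
      using \<sigma>(2) by (auto simp: states_def w successively_append_iff)
  next
    fix w assume w: "w \<in> states M ?m 0"
    then have "w = butlast w @ [M]"
      using states_not_Nil[OF M(1) w] unfolding states_def by (metis (mono_tags, lifting) append_butlast_last_id mem_Collect_eq)
    then obtain u where u: "w = u @ [M]" by blast
    have ms: "mset u = mset_set {1..?m}" and su: "successively eo_step u"
      using w by (auto simp: states_def u successively_append_iff)
    have d: "distinct u"
      unfolding distinct_count_atmost_1 ms using arg_cong[OF ms, of set_mset] by (auto simp: count_mset_set')
    have set: "set u = {1..?m}"
      using arg_cong[OF ms, of set_mset] by simp
    have len: "length u = ?m" using distinct_card[OF d] set by simp
    define \<sigma> where "\<sigma> i = (if i \<in> {1..?m} then u ! (i - 1) else i)" for i
    have word: "word ?m \<sigma> = u"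
      by (rule nth_equalityI) (auto simp: word_def len \<sigma>_def simp del: upt_Suc)
    have "\<sigma> permutes {1..?m}"
    proof (rule bij_imp_permutes)
      have "\<sigma> ` {1..?m} = set (word ?m \<sigma>)"
        by (auto simp: word_def)
      then have "\<sigma> ` {1..?m} = {1..?m}" using word set by simp
      then show "bij_betw \<sigma> {1..?m} {1..?m}"
        by (simp add: bij_betw_def eq_card_imp_inj_on)
    qed (auto simp: \<sigma>_def)
    then have "\<sigma> \<in> even_odd_perms n" using su word by (simp add: even_odd_perms_iff)
    then show "w \<in> (\<lambda>\<sigma>. word ?m \<sigma> @ [M]) ` even_odd_perms n"
      using word u by blast
  qed
qed

lemma Xpoly_eq_state_sum:
  assumes "even M" "2 * n < M"
  shows "Xpoly n a abar b bbar p q y t = state_sum a abar b bbar p q y t M (2 * n) 0"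
  unfolding state_sum_def Xpoly_def
    sum.reindex_bij_betw[OF bij_betw_word_states[OF assms], symmetric]
  by (intro sum.cong refl wt_word[symmetric] assms) (simp add: even_odd_perms_def)

section \<open>Tridiagonal recurrences and continued fractions\<close>

text \<open>
  Let \<open>G h\<close> be the generating function of the column \<open>h\<close> of \<open>T\<close>. The recurrence expresses
  \<open>G h\<close> through \<open>G (h - 1)\<close> and \<open>G (h + 1)\<close>. Substituting \<open>G (h + 1)\<close> in terms of \<open>G h\<close> produces
  one level of the continued fraction, and the error made by cutting off below level \<open>h + N\<close>
  is divisible by a power of \<open>x\<close> that grows with \<open>N\<close>, because \<open>G h\<close> is divisible by \<open>x\<close> to the \<open>h\<close>.
  Only the products of the rising and falling weights of adjacent levels matter.
\<close>

lemma is_jfrac_tridiagonal: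
  fixes T :: "nat \<Rightarrow> nat \<Rightarrow> 'a :: comm_ring_1"
  assumes T_0: "\<And>h. T 0 h = (if h = 0 then 1 else 0)"
    and T_Suc: "\<And>n h. T (Suc n) h =
      T n h * \<beta> h + (if h = 0 then 0 else T n (h - 1) * u (h - 1)) + T n (Suc h) * d (Suc h)"
    and l: "\<And>h. l (Suc h) = u h * d (Suc h)"
  shows "is_jfrac (Abs_fps (\<lambda>n. T n 0)) \<beta> l"
proof -
  define G where "G h = Abs_fps (\<lambda>n. T n h)" for h
  \<comment> \<open>The contribution to \<open>G h\<close> of all that does not come from level \<open>h\<close> or above.\<close>
  define src where "src h = (if h = 0 then 1 else fps_const (u (h - 1)) * fps_X * G (h - 1))" for h
  have step: "T (Suc n) h = \<beta> h * T n h + (if h = 0 then 0 else u (h - 1) * T n (h - 1))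
      + d (Suc h) * T n (Suc h)" for n h
    by (simp add: T_Suc mult.commute)
  have G: "(1 - fps_const (\<beta> h) * fps_X) * G h - src h
      = fps_const (d (Suc h)) * fps_X * G (Suc h)" for h
  proof (rule fps_ext)
    fix n
    show "fps_nth ((1 - fps_const (\<beta> h) * fps_X) * G h - src h) n
        = fps_nth (fps_const (d (Suc h)) * fps_X * G (Suc h)) n"
      by (cases n; cases h)
        (simp_all add: G_def src_def left_diff_distrib mult.assoc T_0 step)
  qed
  have "T n h = 0" if "n < h" for n h
    using that by (induction n arbitrary: h) (simp_all add: T_0 T_Suc)
  then have "G h = fps_X ^ h * Abs_fps (\<lambda>n. T (n + h) h)" for h
    by (auto simp: G_def fps_eq_iff fps_X_power_mult_nth)
  then have order: "fps_X ^ h dvd G h" for h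
    by (metis dvd_triv_left)
  have approx: "fps_X ^ (h + 2 * N + 2) dvd G h - src h * jfrac_convergent \<beta> l N h" for N h
  proof (induction N arbitrary: h)
    case 0
    let ?D = "1 - fps_const (\<beta> h) * fps_X" and ?F = "jfrac_convergent \<beta> l 0 h"
    have "G h - src h * ?F = (?D * ?F) * G h - src h * ?F"
      by (simp only: jfrac_convergent_0_mult mult_1_left)
    also have "\<dots> = ?F * (?D * G h - src h)" by (simp only: algebra_simps)
    also have "\<dots> = fps_X * G (Suc h) * (fps_const (d (Suc h)) * ?F)"
      unfolding G by (simp only: mult_ac)
    also have "fps_X * fps_X ^ Suc h dvd \<dots>"
      by (intro dvd_mult2 mult_dvd_mono order dvd_refl)
    finally show ?case by simp
  next
    case (Suc N)
    let ?F' = "jfrac_convergent \<beta> l N (h + 1)" and ?F = "jfrac_convergent \<beta> l (Suc N) h"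
    let ?D = "1 - fps_const (\<beta> h) * fps_X - fps_const (l (h + 1)) * fps_X ^ 2 * ?F'"
    have "G h - src h * ?F = (?D * ?F) * G h - src h * ?F"
      by (simp only: jfrac_convergent_Suc_mult mult_1_left)
    also have "\<dots> = ?F * (((1 - fps_const (\<beta> h) * fps_X) * G h - src h)
        - fps_const (l (h + 1)) * fps_X ^ 2 * ?F' * G h)"
      by (simp only: algebra_simps)
    also have "\<dots> = ?F * (fps_const (d (Suc h)) * fps_X * (G (h + 1) - src (h + 1) * ?F'))"
      unfolding G
      by (simp add: l src_def algebra_simps power2_eq_square flip: fps_const_mult)
    also have "\<dots> = fps_X * (G (h + 1) - src (h + 1) * ?F') * (?F * fps_const (d (Suc h)))"
      by (simp only: mult_ac)
    also have "fps_X * fps_X ^ (h + 1 + 2 * N + 2) dvd \<dots>"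
      by (intro dvd_mult2 mult_dvd_mono Suc.IH dvd_refl)
    finally show ?case by (simp add: mult_ac)
  qed
  show ?thesis
    unfolding is_jfrac_def
  proof (rule tendsto_fpsI)
    fix n
    have "fps_nth (jfrac_convergent \<beta> l N 0) n = fps_nth (Abs_fps (\<lambda>n. T n 0)) n" if "n \<le> N" for N
    proof -
      obtain E where "G 0 - src 0 * jfrac_convergent \<beta> l N 0 = fps_X ^ (2 * N + 2) * E"
        using approx[of 0 N] by (auto elim: dvdE)
      then have "fps_nth (G 0 - src 0 * jfrac_convergent \<beta> l N 0) n = 0"
        using that by (simp only: fps_X_power_mult_nth) simp
      then show ?thesis by (simp add: src_def G_def)
    qed
    then show "\<forall>\<^sub>F N in sequentially. fps_nth (jfrac_convergent \<beta> l N 0) n = fps_nth (Abs_fps (\<lambda>n. T n 0)) n"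
      by (auto simp: eventually_sequentially)
  qed
qed

text \<open>
  The solution of the recurrence, to compare with \<open>state_sum\<close>: for each number of letters
  \<open>state_sum\<close> needs a marker large enough, and no single marker serves all of them. It sums the
  weights of the Motzkin paths of length \<open>n\<close> that end at height \<open>h\<close>.
\<close>

primrec path_sum :: "(nat \<Rightarrow> 'a) \<Rightarrow> (nat \<Rightarrow> 'a) \<Rightarrow> (nat \<Rightarrow> 'a) \<Rightarrow> nat \<Rightarrow> nat \<Rightarrow> 'a :: comm_ring_1" where
  "path_sum \<beta> u d 0 h = (if h = 0 then 1 else 0)"
| "path_sum \<beta> u d (Suc n) h =
     path_sum \<beta> u d n h * \<beta> h + (if h = 0 then 0 else path_sum \<beta> u d n (h - 1) * u (h - 1))
     + path_sum \<beta> u d n (Suc h) * d (Suc h)"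

theorem theorem4:
  fixes a abar b bbar p q y t :: "'a :: comm_ring_1"
    and \<beta> lam :: "nat \<Rightarrow> 'a"
  assumes beta: "\<And>n. n \<ge> 1 \<Longrightarrow>
      \<beta> (n - 1) = bracket3 p q abar n b * bracket3 p q a n bbar
                    + t * y * bracket2 p q a n * bracket2 q p b n"
    and lam: "\<And>n. n \<ge> 1 \<Longrightarrow>
      lam n = t * bracket2 p q a n * bracket3 p q a (n + 1) bbar
                * bracket2 q p b n * bracket3 p q abar (n + 1) b"
  shows "is_jfrac (Abs_fps (\<lambda>n. if n = 0 then 1 else Xpoly n a abar b bbar p q y t)) \<beta> lam
         \<and> \<beta> 0 = a * b * (abar * bbar + t * y)
         \<and> lam 1 = a * b * t * (a * p + bbar * q) * (abar * p + b * q)"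
proof (intro conjI)
  \<comment> \<open>The weights of a rise (a valley, then a double ascent) and of a fall (a double ascent, then a peak).\<close>
  define u where "u h = t * bracket2 q p b (Suc h) * bracket3 p q a (Suc (Suc h)) bbar" for h
  define d where "d h = bracket3 p q abar (Suc h) b * bracket2 p q a h" for h
  let ?T = "path_sum \<beta> u d"
  have \<beta>: "\<beta> h = bracket3 p q abar (Suc h) b * bracket3 p q a (Suc h) bbar
      + t * y * bracket2 p q a (Suc h) * bracket2 q p b (Suc h)" for h
    using beta[of "Suc h"] by simp
  have state_sum: "state_sum a abar b bbar p q y t M (2 * n) h = ?T n h"
    if "even M" "2 * n < M" for M n h
    using that(2)
  proof (induction n arbitrary: h)
    case 0
    show ?case by (simp add: state_sum_0[OF that(1)])
  next
    case (Suc n)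
    then have "2 * n < M" "2 * n + 2 < M" by simp_all
    then show ?case
      using state_sum_step[OF that(1), of "2 * n" a abar b bbar p q y t h] Suc.IH
      by (cases h) (simp_all add: \<beta> u_def d_def)
  qed
  have "(if n = 0 then 1 else Xpoly n a abar b bbar p q y t) = ?T n 0" for n
    using Xpoly_eq_state_sum[of "2 * n + 2" n a abar b bbar p q y t] state_sum[of "2 * n + 2" n 0]
    by auto
  moreover have "is_jfrac (Abs_fps (\<lambda>n. ?T n 0)) \<beta> lam"
  proof (rule is_jfrac_tridiagonal[where u = u and d = d])
    show "lam (Suc h) = u h * d (Suc h)" for h
      by (simp add: lam u_def d_def mult_ac)
  qed simp_all
  ultimately show "is_jfrac (Abs_fps (\<lambda>n. if n = 0 then 1 else Xpoly n a abar b bbar p q y t)) \<beta> lam"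
    by presburger
  show "\<beta> 0 = a * b * (abar * bbar + t * y)"
    using beta[of 1] by (simp add: bracket3_def bracket2_def algebra_simps)
  show "lam 1 = a * b * t * (a * p + bbar * q) * (abar * p + b * q)"
    using lam[of 1] by (simp add: bracket3_def bracket2_def mult_ac)
qed

end
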